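(* Let $(\phi_t)$ be a parabolic semigroup of zero hyperbolic step in $\mathbb{D}$ whose Koenigs domain $\Omega$ satisfies $\Omega\subseteq\mathbb{C}\setminus\{-t:t\ge0\}$, and let $(T_t)$ be the induced semigroup of composition operators on the Dirichlet space $\mathcal{D}$. Let $\sigma_{\mathcal{D}}$ be the point spectrum of the infinitesimal generator of $(T_t)$. With $\theta_\Omega^\pm,\Theta_\Omega^\pm$ the upper/lower inner and outer arguments, and $\theta_\Omega=\theta_\Omega^-+\theta_\Omega^+$, $\Theta_\Omega=\Theta_\Omega^-+\Theta_\Omega^+$, the following hold: (a) If $\theta_\Omega=\Theta_\Omega=0$, then $\sigma_{\mathcal{D}}=iS(0,\pi)\cup\{0\}$. (b) If $\theta_\Omega=\Theta_\Omega\in(0,\pi)$ (and hence $\theta_\Omega^-=\Theta_\Omega^-$, $\theta_\Omega^+=\Theta_\Omega^+$), then $iS(\theta_\Omega^-,\pi-\theta_\Omega^+)\cup\{0\}\subseteq\sigma_{\mathcal{D}}\subseteq i\overline{S(\theta_\Omega^-,\pi-\theta_\Omega^+)}$. (c) If $\theta_\Omega=\pi$, then $\sigma_{\mathcal{D}}\subseteq\{ite^{i\theta_\Omega^-}:t\ge0\}$. (d) If $\theta_\Omega\in(\pi,2\pi]$, then $\sigma_{\mathcal{D}}=\{0\}$. (e) If $\theta_\Omega<\min\{\pi,\Theta_\Omega\}$, then $iS(\Theta_\Omega^-,\pi-\Theta_\Omega^+)\cup\{0\}\subseteq\sigma_{\mathcal{D}}\subseteq i\overline{S(\theta_\Omega^-,\pi-\theta_\Omega^+)}$,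 where in case $\Theta_\Omega\ge\pi$ the set on the left is replaced by $\{0\}$, and in case $\theta_\Omega=0$ the set on the right is replaced by $iS(0,\pi)\cup\{0\}$.
   Context: $\mathbb{D}$ is the open unit disk. A semigroup in $\mathbb{D}$ is a family $(\phi_t)_{t\ge0}$ of holomorphic maps $\phi_t:\mathbb{D}\to\mathbb{D}$ with $\phi_0=\mathrm{id}$, $\phi_{t+s}=\phi_t\circ\phi_s$ for all $t,s\ge0$, and $\phi_t(z)\to z$ uniformly on compacta as $t\to0^+$. It is non-elliptic if there is $\tau\in\partial\mathbb{D}$ (the Denjoy–Wolff point) with $\phi_t(z)\to\tau$ as $t\to+\infty$ for all $z\in\mathbb{D}$; a non-elliptic semigroup is parabolic if the angular derivative satisfies $\phi_1'(\tau)=1$. For a non-elliptic semigroup there is a univalent map $h:\mathbb{D}\to\mathbb{C}$, unique up to translation, the Koenigs function, with $h(\phi_t(z))=h(z)+t$ for all $t\ge0$, $z\in\mathbb{D}$; $\Omega:=h(\mathbb{D})$ is the Koenigs domain. A parabolic semigroup is of zero hyperbolic step if $\Omega$ is not contained in any horizontal half-plane $\{\mathrm{Im}\,w>c\}$ or $\{\mathrm{Im}\,w<c\}$. For $a<b$ in $[-\pi,\pi]$: $S(a,b)=\{w\in\mathbb{C}:a<\arg w<b\}$, and $\overline{S(a,b)}$ is its topological closure in $\mathbb{C}$; $iE=\{iw:w\in E\}$. Put $\Omega^-=\Omega\cap S(-\pi,0)$ and $\Omega^+=\Omega\cap S(0,\pi)$ (both non-empty and connected). Define $\theta_\Omega^-=\sup(\{0\}\cup\{\theta\in(0,\pi]:\exists\,q_\theta\in\mathbb{C}\text{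 with }q_\theta+S(-\theta,0)\subseteq\Omega^-\})$, $\Theta_\Omega^-=\inf\{\theta\in(0,\pi]:\exists\,q_\theta\in\mathbb{C}\text{ with }\Omega^-\subseteq q_\theta+S(-\theta,0)\}$, $\theta_\Omega^+=\sup(\{0\}\cup\{\theta\in(0,\pi]:\exists\,q_\theta\in\mathbb{C}\text{ with }q_\theta+S(0,\theta)\subseteq\Omega^+\})$, $\Theta_\Omega^+=\inf\{\theta\in(0,\pi]:\exists\,q_\theta\in\mathbb{C}\text{ with }\Omega^+\subseteq q_\theta+S(0,\theta)\}$ (lower inner, lower outer, upper inner, upper outer arguments). The Dirichlet space $\mathcal{D}$ is the space of holomorphic $f:\mathbb{D}\to\mathbb{C}$ with $\int_{\mathbb{D}}|f'(z)|^2\,dA(z)<+\infty$ ($dA$ normalized area measure), with its usual norm. $T_t(f)=f\circ\phi_t$, $f\in\mathcal{D}$, is a strongly continuous semigroup of bounded operators; its infinitesimal generator is $\Gamma_{\mathcal{D}}(f)=\lim_{t\to0^+}(T_t(f)-f)/t$ (norm limit), defined on those $f\in\mathcal{D}$ for which the limit exists in $\mathcal{D}$. The point spectrum is the set of eigenvalues $\lambda\in\mathbb{C}$ of $\Gamma_{\mathcal{D}}$. *)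

theory Defs
  imports "HOL-Complex_Analysis.Complex_Analysis"
begin

abbreviation unit_disk :: "complex set" where
  "unit_disk \<equiv> ball 0 1"

section \<open>Semigroups of holomorphic self-maps of the disk\<close>

text \<open>Only the maps \<open>\<phi> t\<close> with \<open>t \<ge> 0\<close>, restricted to the disk, are meaningful.\<close>

definition holo_semigroup :: "(real \<Rightarrow> complex \<Rightarrow> complex) \<Rightarrow> bool" where
  "holo_semigroup \<phi> \<longleftrightarrow>
     (\<forall>t\<ge>0. \<phi> t holomorphic_on unit_disk \<and> \<phi> t ` unit_disk \<subseteq> unit_disk) \<and>
     (\<forall>z\<in>unit_disk. \<phi> 0 z = z) \<and>
     (\<forall>t\<ge>0. \<forall>s\<ge>0. \<forall>z\<in>unit_disk. \<phi> (t + s) z = \<phi> t (\<phi> s z)) \<and>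
     (\<forall>K. compact K \<and> K \<subseteq> unit_disk \<longrightarrow> uniform_limit K \<phi> (\<lambda>z. z) (at_right 0))"

definition denjoy_wolff_point :: "(real \<Rightarrow> complex \<Rightarrow> complex) \<Rightarrow> complex \<Rightarrow> bool" where
  "denjoy_wolff_point \<phi> \<tau> \<longleftrightarrow>
     cmod \<tau> = 1 \<and> (\<forall>z\<in>unit_disk. ((\<lambda>t. \<phi> t z) \<longlongrightarrow> \<tau>) at_top)"

definition stolz_region :: "complex \<Rightarrow> real \<Rightarrow> complex set" where
  "stolz_region \<tau> M = {z \<in> unit_disk. cmod (\<tau> - z) < M * (1 - cmod z)}"

definition has_angular_limit :: "(complex \<Rightarrow> complex) \<Rightarrow> complex \<Rightarrow> complex \<Rightarrow> bool" where
  "has_angular_limit f \<tau> l \<longleftrightarrow> (\<forall>M>1. (f \<longlongrightarrow> l) (at \<tau> within stolz_region \<tau> M))"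

text \<open>The boundary value \<open>\<sigma>\<close> replaces \<open>f \<tau>\<close>, which is meaningless for a map of the open disk.\<close>

definition has_angular_derivative :: "(complex \<Rightarrow> complex) \<Rightarrow> complex \<Rightarrow> complex \<Rightarrow> bool" where
  "has_angular_derivative f \<tau> d \<longleftrightarrow>
     (\<exists>\<sigma>. has_angular_limit f \<tau> \<sigma> \<and> has_angular_limit (\<lambda>z. (f z - \<sigma>) / (z - \<tau>)) \<tau> d)"

definition parabolic_semigroup :: "(real \<Rightarrow> complex \<Rightarrow> complex) \<Rightarrow> bool" where
  "parabolic_semigroup \<phi> \<longleftrightarrow>
     holo_semigroup \<phi> \<and> (\<exists>\<tau>. denjoy_wolff_point \<phi> \<tau> \<and> has_angular_derivative (\<phi> 1) \<tau> 1)"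

definition koenigs_function ::
    "(real \<Rightarrow> complex \<Rightarrow> complex) \<Rightarrow> (complex \<Rightarrow> complex) \<Rightarrow> bool" where
  "koenigs_function \<phi> h \<longleftrightarrow>
     h holomorphic_on unit_disk \<and> inj_on h unit_disk \<and>
     (\<forall>t\<ge>0. \<forall>z\<in>unit_disk. h (\<phi> t z) = h z + of_real t)"

text \<open>The Koenigs function is unique up to an additive constant, so a Koenigs domain is
  determined up to translation.\<close>

definition koenigs_domain :: "(real \<Rightarrow> complex \<Rightarrow> complex) \<Rightarrow> complex set \<Rightarrow> bool" where
  "koenigs_domain \<phi> \<Omega> \<longleftrightarrow> (\<exists>h. koenigs_function \<phi> h \<and> \<Omega> = h ` unit_disk)"

text \<open>A property of the semigroup, read off from any of its Koenigs domains: the condition is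
  invariant under translation of \<open>\<Omega>\<close>.\<close>

definition zero_hyperbolic_step :: "complex set \<Rightarrow> bool" where
  "zero_hyperbolic_step \<Omega> \<longleftrightarrow>
     \<not> (\<exists>c. \<Omega> \<subseteq> {w. Im w > c}) \<and> \<not> (\<exists>c. \<Omega> \<subseteq> {w. Im w < c})"

section \<open>Inner and outer arguments\<close>

text \<open>\<open>Arg\<close> takes values in \<open>{-pi<..pi}\<close>; the vertex is excluded explicitly because of the
  convention \<open>Arg 0 = 0\<close>.\<close>

definition sector :: "real \<Rightarrow> real \<Rightarrow> complex set" where
  "sector a b = {w. w \<noteq> 0 \<and> a < Arg w \<and> Arg w < b}"

definition lower_part :: "complex set \<Rightarrow> complex set" where
  "lower_part \<Omega> = \<Omega> \<inter> sector (- pi) 0"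

definition upper_part :: "complex set \<Rightarrow> complex set" where
  "upper_part \<Omega> = \<Omega> \<inter> sector 0 pi"

definition lower_inner_arg :: "complex set \<Rightarrow> real" where
  "lower_inner_arg \<Omega> =
     Sup ({0} \<union> {\<theta>\<in>{0<..pi}. \<exists>q. (\<lambda>w. q + w) ` sector (- \<theta>) 0 \<subseteq> lower_part \<Omega>})"

definition lower_outer_arg :: "complex set \<Rightarrow> real" where
  "lower_outer_arg \<Omega> =
     Inf {\<theta>\<in>{0<..pi}. \<exists>q. lower_part \<Omega> \<subseteq> (\<lambda>w. q + w) ` sector (- \<theta>) 0}"

definition upper_inner_arg :: "complex set \<Rightarrow> real" where
  "upper_inner_arg \<Omega> =
     Sup ({0} \<union> {\<theta>\<in>{0<..pi}. \<exists>q. (\<lambda>w. q + w) ` sector 0 \<theta> \<subseteq> upper_part \<Omega>})"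

definition upper_outer_arg :: "complex set \<Rightarrow> real" where
  "upper_outer_arg \<Omega> =
     Inf {\<theta>\<in>{0<..pi}. \<exists>q. upper_part \<Omega> \<subseteq> (\<lambda>w. q + w) ` sector 0 \<theta>}"

definition inner_arg :: "complex set \<Rightarrow> real" where
  "inner_arg \<Omega> = lower_inner_arg \<Omega> + upper_inner_arg \<Omega>"

definition outer_arg :: "complex set \<Rightarrow> real" where
  "outer_arg \<Omega> = lower_outer_arg \<Omega> + upper_outer_arg \<Omega>"

section \<open>The Dirichlet space and the generator\<close>

text \<open>Elements are represented by total functions, of which only the restriction to the disk
  matters; normalized area measure is Lebesgue measure divided by \<open>pi\<close>.\<close>

definition dirichlet_space :: "(complex \<Rightarrow> complex) set" where
  "dirichlet_space = {f. f holomorphic_on unit_disk \<and>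
     set_integrable lborel unit_disk (\<lambda>z. (cmod (deriv f z))\<^sup>2)}"

definition dirichlet_norm :: "(complex \<Rightarrow> complex) \<Rightarrow> real" where
  "dirichlet_norm f =
     sqrt ((cmod (f 0))\<^sup>2 + (LINT z:unit_disk|lborel. (cmod (deriv f z))\<^sup>2) / pi)"

definition composition_op ::
    "(real \<Rightarrow> complex \<Rightarrow> complex) \<Rightarrow> real \<Rightarrow> (complex \<Rightarrow> complex) \<Rightarrow> complex \<Rightarrow> complex" where
  "composition_op \<phi> t f = f \<circ> \<phi> t"

text \<open>The graph of the infinitesimal generator: \<open>f\<close> lies in its domain and is mapped to \<open>g\<close>.
  As a function on the disk, \<open>g\<close> is determined by \<open>f\<close>.\<close>

definition dirichlet_generator ::
    "(real \<Rightarrow> complex \<Rightarrow> complex) \<Rightarrow> (complex \<Rightarrow> complex) \<Rightarrow> (complex \<Rightarrow> complex) \<Rightarrow> bool" where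
  "dirichlet_generator \<phi> f g \<longleftrightarrow>
     f \<in> dirichlet_space \<and> g \<in> dirichlet_space \<and>
     ((\<lambda>t. dirichlet_norm (\<lambda>z. (composition_op \<phi> t f z - f z) / of_real t - g z)) \<longlongrightarrow> 0)
       (at_right 0)"

definition dirichlet_point_spectrum :: "(real \<Rightarrow> complex \<Rightarrow> complex) \<Rightarrow> complex set" where
  "dirichlet_point_spectrum \<phi> =
     {\<mu>. \<exists>f. (\<exists>z\<in>unit_disk. f z \<noteq> 0) \<and> dirichlet_generator \<phi> f (\<lambda>z. \<mu> * f z)}"

definition rot_i :: "complex set \<Rightarrow> complex set" where
  "rot_i E = (\<lambda>w. \<i> * w) ` E"

end

theory Submission
  imports Defs "HOL-Real_Asymp.Real_Asymp"
begin

text \<open>The Koenigs function \<open>h\<close> turns the semigroup into the translations \<open>w \<mapsto> w + t\<close> of the Koenigs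
  domain \<open>\<Omega>\<close>. Composition with a translation is generated by \<open>d/dw\<close>, so the only candidates for
  eigenfunctions with eigenvalue \<open>\<mu>\<close> are the multiples of \<open>exp (\<mu> * h z)\<close>
  (\<open>eigenfunction_is_exponential\<close>). As the Dirichlet integral is conformally invariant
  (\<open>set_integrable_holomorphic_substitution\<close>), such a function belongs to the Dirichlet space
  exactly if \<open>\<mu> = 0\<close> or the weight \<open>exp (2 * Re (\<mu> * w))\<close> is integrable over \<open>\<Omega>\<close>
  (\<open>dirichlet_point_spectrum_iff\<close>). The spectral problem thereby becomes one of plane geometry.

  An integrable weight cannot stay bounded away from zero on parts of \<open>\<Omega>\<close> of arbitrarily large area.
  Since \<open>\<Omega>\<close> contains a half-strip stretching to the right, \<open>Re \<mu> < 0\<close>, that is,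
  \<open>\<mu> = r * (\<i> * cis \<psi>)\<close> with \<open>r > 0\<close> and \<open>0 < \<psi> < pi\<close>; and since \<open>Re (\<mu> * w)\<close> is
  \<open>- r * cmod w * sin (\<psi> + Arg w)\<close>, a sector inside \<open>\<Omega>\<close> may contain no direction \<open>\<alpha>\<close> with
  \<open>sin (\<psi> + \<alpha>) < 0\<close>. Taking the largest such sectors below and above the real axis yields
  \<open>lower_inner_arg \<Omega> \<le> \<psi> \<le> pi - upper_inner_arg \<Omega>\<close>
  (\<open>integrable_exp_weight_imp_angle_bounds\<close>).

  Conversely, if \<open>lower_outer_arg \<Omega> < \<psi> < pi - upper_outer_arg \<Omega>\<close>, both halves of \<open>\<Omega>\<close> lie in sectors
  whose closed ranges of directions satisfy \<open>sin (\<psi> + \<alpha>) > 0\<close>. There the weight decays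
  exponentially, uniformly in the direction, and is integrable
  (\<open>angle_bounds_imp_integrable_exp_weight\<close>). Together with the comparison of inner and outer
  arguments (\<open>inner_arg_le_outer_arg\<close>) these two implications contain all the cases.\<close>

section \<open>Change of variables under an injective holomorphic map\<close>

text \<open>The change of variables theorem speaks of maps of \<open>real ^ 'n\<close>, so planar integrals are moved
  there and back by this pair of mutually inverse linear isometries.\<close>
definition complex_of_vec :: "real ^ 2 \<Rightarrow> complex" where
  "complex_of_vec x = Complex (x $ 1) (x $ 2)"

definition vec_of_complex :: "complex \<Rightarrow> real ^ 2" where
  "vec_of_complex z = vector [Re z, Im z]"

lemma vec_complex_inverse [simp]:
  "complex_of_vec (vec_of_complex z) = z" "vec_of_complex (complex_of_vec x) = x"
  by (simp_all add: complex_of_vec_def vec_of_complex_def complex_eq_iff vec_eq_iff forall_2)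

lemma linear_complex_of_vec: "linear complex_of_vec"
  by (rule linearI) (auto simp: complex_of_vec_def complex_eq_iff)

lemma linear_vec_of_complex: "linear vec_of_complex"
  by (rule linearI) (auto simp: vec_of_complex_def vec_eq_iff forall_2)

lemma borel_measurable_complex_of_vec [measurable]: "complex_of_vec \<in> borel_measurable borel"
  by (intro borel_measurable_continuous_onI linear_continuous_on linear_conv_bounded_linear[THEN iffD1] linear_complex_of_vec)

lemma lborel_complex_eq_distr:
  "(lborel :: complex measure) = distr lborel borel complex_of_vec"
proof (rule lborel_eqI)
  fix l u :: complex assume le: "\<And>b. b \<in> Basis \<Longrightarrow> l \<bullet> b \<le> u \<bullet> b"
  have pre: "complex_of_vec -` box l u = box (vec_of_complex l) (vec_of_complex u)"
    by (auto simp: complex_of_vec_def vec_of_complex_def box_def Basis_complex_def Basis_vec_def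
        inner_axis forall_2)
  have B: "(Basis :: (real^2) set) = {axis 1 1, axis 2 1}"
    by (auto simp: Basis_vec_def UNIV_2)
  have "axis (1::2) (1::real) \<noteq> axis 2 1" by (simp add: axis_eq_axis)
  have le': "Re l \<le> Re u" "Im l \<le> Im u"
    using le[of 1] le[of \<i>] by (auto simp: Basis_complex_def)
  have "emeasure (distr lborel borel complex_of_vec) (box l u) =
      emeasure lborel (box (vec_of_complex l) (vec_of_complex u))"
    by (subst emeasure_distr) (auto simp: pre)
  also have "\<dots> = (\<Prod>b\<in>Basis. (vec_of_complex u - vec_of_complex l) \<bullet> b)"
    by (rule emeasure_lborel_box) (use le' in \<open>auto simp: B inner_axis vec_of_complex_def\<close>)
  also have "\<dots> = (\<Prod>b\<in>Basis. (u - l) \<bullet> b)"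
    using \<open>axis (1::2) (1::real) \<noteq> axis 2 1\<close>
    by (auto simp: B Basis_complex_def inner_axis vec_of_complex_def complex_eq_iff)
  finally show "emeasure (distr lborel borel complex_of_vec) (box l u) = (\<Prod>b\<in>Basis. (u - l) \<bullet> b)" .
qed simp

text \<open>Openness and continuity make the extension of \<open>f\<close> by zero Borel measurable, and for Borel
  functions integrability with respect to \<open>lborel\<close> and to its completion coincide.\<close>
lemma set_integrable_complex_iff_vec:
  fixes f :: "complex \<Rightarrow> real"
  assumes S: "open S" and f: "continuous_on S f"
  shows "set_integrable lborel S f \<longleftrightarrow>
    (\<lambda>x. f (complex_of_vec x)) absolutely_integrable_on (vec_of_complex ` S)"
proof -
  have meas [measurable]: "(\<lambda>x. indicator S x *\<^sub>R f x) \<in> borel_measurable borel"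
    by (rule borel_measurable_continuous_on_indicator[OF borel_open[OF S] f])
  have ind: "indicator S (complex_of_vec x) = (indicator (vec_of_complex ` S) x :: real)" for x
    by (auto simp: indicator_def intro!: image_eqI[of _ _ "complex_of_vec x"])
  have "set_integrable lborel S f \<longleftrightarrow>
      integrable lborel (\<lambda>x. indicator S (complex_of_vec x) *\<^sub>R f (complex_of_vec x))"
    unfolding set_integrable_def by (subst lborel_complex_eq_distr, subst integrable_distr_eq)
      (use meas in \<open>simp_all del: real_scaleR_def\<close>)
  also have "\<dots> \<longleftrightarrow>
      integrable lebesgue (\<lambda>x. indicator S (complex_of_vec x) *\<^sub>R f (complex_of_vec x))"
    by (subst integrable_completion)
      (use measurable_compose[OF borel_measurable_complex_of_vec meas] in \<open>simp_all del: real_scaleR_def\<close>)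
  finally show ?thesis unfolding set_integrable_def ind .
qed

text \<open>Multiplication by \<open>c\<close> has the matrix with rows \<open>(Re c, - Im c)\<close> and \<open>(Im c, Re c)\<close>; this is
  how \<open>(cmod (deriv h z))\<^sup>2\<close> arises as the Jacobian determinant of a holomorphic map.\<close>
lemma abs_det_complex_multiplication:
  "\<bar>det (matrix (\<lambda>x. vec_of_complex (c * complex_of_vec x)))\<bar> = (cmod c)\<^sup>2"
proof -
  have "det (matrix (\<lambda>x. vec_of_complex (c * complex_of_vec x))) = Re c * Re c + Im c * Im c"
    by (simp add: det_2 matrix_def complex_of_vec_def vec_of_complex_def axis_def)
  thus ?thesis by (simp add: cmod_power2) (simp add: power2_eq_square)
qed

text \<open>The Dirichlet integral is conformally invariant. This is the form of that fact used below, for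
  the Koenigs function as well as for the maps of the semigroup.\<close>
theorem set_integrable_holomorphic_substitution:
  fixes F :: "complex \<Rightarrow> real"
  assumes S: "open S" and h: "h holomorphic_on S" and inj: "inj_on h S"
    and F: "continuous_on (h ` S) F"
  shows "set_integrable lborel (h ` S) F \<longleftrightarrow>
    set_integrable lborel S (\<lambda>z. (cmod (deriv h z))\<^sup>2 * F (h z))"
proof -
  have hS: "open (h ` S)" by (rule open_mapping_thm3[OF h S inj])
  let ?S = "vec_of_complex ` S"
  let ?g = "\<lambda>x. vec_of_complex (h (complex_of_vec x))"
  let ?g' = "\<lambda>x y. vec_of_complex (deriv h (complex_of_vec x) * complex_of_vec y)"
  let ?F = "\<lambda>x. vec (F (complex_of_vec x)) :: real^1"
  have contdh: "continuous_on S (\<lambda>z. (cmod (deriv h z))\<^sup>2 * F (h z))"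
    by (intro continuous_intros holomorphic_on_imp_continuous_on holomorphic_deriv h S
        continuous_on_compose2[OF F]) auto
  have im: "?g ` ?S = vec_of_complex ` h ` S" by (auto simp: image_comp o_def)
  have "open ?S"
  proof -
    have "?S = complex_of_vec -` S"
      by (auto intro!: image_eqI[of _ _ "complex_of_vec _"])
    thus ?thesis
      by (simp add: continuous_open_vimage[OF S] linear_continuous_at linear_conv_bounded_linear[symmetric] linear_complex_of_vec)
  qed
  have der: "(?g has_derivative ?g' x) (at x within ?S)" if x: "x \<in> ?S" for x
  proof -
    have xS: "complex_of_vec x \<in> S" using x by auto
    have d1: "(complex_of_vec has_derivative complex_of_vec) (at x within ?S)"
      using linear_complex_of_vec linear_conv_bounded_linear bounded_linear_imp_has_derivative by blast
    have "(h has_field_derivative deriv h (complex_of_vec x)) (at (complex_of_vec x))"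
      using holomorphic_derivI[OF h S xS] .
    hence d2: "(h has_derivative (*) (deriv h (complex_of_vec x))) (at (complex_of_vec x))"
      by (simp add: has_field_derivative_def)
    have d3: "(vec_of_complex has_derivative vec_of_complex) (at y)" for y
      using linear_vec_of_complex linear_conv_bounded_linear bounded_linear_imp_has_derivative by blast
    have "((\<lambda>x. h (complex_of_vec x)) has_derivative (\<lambda>y. deriv h (complex_of_vec x) * complex_of_vec y)) (at x within ?S)"
      using has_derivative_compose[OF d1 d2] .
    from has_derivative_compose[OF this d3] show ?thesis .
  qed
  have injg: "inj_on ?g ?S"
    using inj by (auto simp: inj_on_def) (metis vec_complex_inverse(1))
  have "set_integrable lborel (h ` S) F \<longleftrightarrow> ?F absolutely_integrable_on (?g ` ?S)"
    by (simp add: set_integrable_complex_iff_vec[OF hS F] im absolutely_integrable_on_1_iff)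
  also have "\<dots> \<longleftrightarrow> (\<lambda>x. \<bar>det (matrix (?g' x))\<bar> *\<^sub>R ?F (?g x)) absolutely_integrable_on ?S"
    by (rule absolutely_integrable_change_of_variables)
      (use der injg \<open>open ?S\<close> in \<open>auto simp: borel_open lebesgue_openin\<close>)
  also have "\<dots> \<longleftrightarrow> set_integrable lborel S (\<lambda>z. (cmod (deriv h z))\<^sup>2 * F (h z))"
    by (simp add: set_integrable_complex_iff_vec[OF S contdh] absolutely_integrable_on_1_iff
        abs_det_complex_multiplication)
  finally show ?thesis .
qed

section \<open>Limits and algebra in the Dirichlet space\<close>

text \<open>Pointwise convergence is known here, and only the value of the limit is in question: by
  Fatou's lemma the limit has \<open>L\<^sup>2\<close> norm zero, so it vanishes almost everywhere, hence
  everywhere by continuity.\<close>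
lemma L2_limit_zero_imp_pointwise_limit_zero:
  fixes f :: "nat \<Rightarrow> complex \<Rightarrow> complex"
  assumes U: "open U" and contf: "\<And>n. continuous_on U (f n)" and contg: "continuous_on U g"
    and lim: "\<And>z. z \<in> U \<Longrightarrow> (\<lambda>n. f n z) \<longlonglongrightarrow> g z"
    and int: "\<And>n. set_integrable lborel U (\<lambda>z. (cmod (f n z))\<^sup>2)"
    and L2: "(\<lambda>n. LINT z:U|lborel. (cmod (f n z))\<^sup>2) \<longlonglongrightarrow> 0"
    and z: "z \<in> U"
  shows "g z = 0"
proof -
  define u where "u n x = ennreal (indicator U x *\<^sub>R (cmod (f n x))\<^sup>2)" for n x
  define v where "v x = ennreal (indicator U x *\<^sub>R (cmod (g x))\<^sup>2)" for x
  have meas: "u n \<in> borel_measurable lborel" for n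
    unfolding u_def measurable_lborel2
    by (intro measurable_compose[OF _ measurable_ennreal] borel_measurable_continuous_on_indicator
        borel_open U continuous_intros contf)
  have measv: "v \<in> borel_measurable lborel"
    unfolding v_def measurable_lborel2
    by (intro measurable_compose[OF _ measurable_ennreal] borel_measurable_continuous_on_indicator
        borel_open U continuous_intros contg)
  have "(\<lambda>n. u n x) \<longlonglongrightarrow> v x" for x
  proof (cases "x \<in> U")
    case True
    show ?thesis unfolding u_def v_def by (intro tendsto_intros tendsto_ennrealI lim True)
  qed (auto simp: u_def v_def)
  hence "v x = liminf (\<lambda>n. u n x)" for x
    by (metis lim_imp_Liminf trivial_limit_sequentially)
  hence "integral\<^sup>N lborel v = (\<integral>\<^sup>+x. liminf (\<lambda>n. u n x) \<partial>lborel)" by (intro nn_integral_cong)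
  also have "\<dots> \<le> liminf (\<lambda>n. integral\<^sup>N lborel (u n))" by (intro nn_integral_liminf meas)
  also have "(\<lambda>n. integral\<^sup>N lborel (u n)) = (\<lambda>n. ennreal (LINT z:U|lborel. (cmod (f n z))\<^sup>2))"
    using int unfolding u_def set_integrable_def set_lebesgue_integral_def
    by (intro ext nn_integral_eq_integral) auto
  also have "liminf \<dots> = 0"
    using tendsto_ennrealI[OF L2] by (simp add: lim_imp_Liminf)
  finally have "integral\<^sup>N lborel v = 0" by simp
  hence AE: "AE x in lborel. v x = 0" using nn_integral_0_iff_AE[OF measv] by simp
  \<comment> \<open>An open set on which a false statement holds almost everywhere is empty.\<close>
  define S where "S = {x \<in> U. g x \<noteq> 0}"
  have "open S"
    using continuous_open_preimage[OF contg U, of "-{0}"] by (auto simp: S_def Int_def vimage_def)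
  moreover have "AE x \<in> S in lebesgue. x \<in> {}"
    by (rule AE_completion, rule AE_mp[OF AE], rule AE_I2) (auto simp: S_def v_def)
  ultimately have "S = {}" using mem_closed_if_AE_lebesgue_open[of S "{}"] by blast
  thus ?thesis using z by (auto simp: S_def)
qed

lemma dirichlet_space_linear_combination:
  assumes f: "f \<in> dirichlet_space" and g: "g \<in> dirichlet_space"
  shows "(\<lambda>z. a * f z + b * g z) \<in> dirichlet_space"
proof -
  have hol: "f holomorphic_on unit_disk" "g holomorphic_on unit_disk"
    using f g by (auto simp: dirichlet_space_def)
  let ?k = "\<lambda>z. a * f z + b * g z"
  have der: "deriv ?k z = a * deriv f z + b * deriv g z" if "z \<in> unit_disk" for z
    by (rule DERIV_imp_deriv)
      (auto intro!: derivative_eq_intros holomorphic_derivI[OF hol(1) _ that] holomorphic_derivI[OF hol(2) _ that])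
  have holk: "?k holomorphic_on unit_disk" by (intro holomorphic_intros hol)
  have "set_integrable lborel unit_disk
      (\<lambda>z. 2 * (cmod a)\<^sup>2 * (cmod (deriv f z))\<^sup>2 + 2 * (cmod b)\<^sup>2 * (cmod (deriv g z))\<^sup>2)"
    using f g by (intro set_integral_add set_integrable_mult_right) (auto simp: dirichlet_space_def)
  hence "set_integrable lborel unit_disk (\<lambda>z. (cmod (deriv ?k z))\<^sup>2)"
  proof (rule set_integrable_bound)
    show "set_borel_measurable lborel unit_disk (\<lambda>z. (cmod (deriv ?k z))\<^sup>2)"
      unfolding set_borel_measurable_def measurable_lborel2
      by (intro borel_measurable_continuous_on_indicator borel_open continuous_intros
          holomorphic_on_imp_continuous_on holomorphic_deriv holk) auto
    have "(cmod (x + y))\<^sup>2 \<le> 2 * (cmod x)\<^sup>2 + 2 * (cmod y)\<^sup>2" for x y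
    proof -
      have "(cmod (x + y))\<^sup>2 \<le> (cmod x + cmod y)\<^sup>2" by (intro power_mono norm_triangle_ineq) auto
      also have "\<dots> \<le> 2 * (cmod x)\<^sup>2 + 2 * (cmod y)\<^sup>2"
        using sum_squares_bound[of "cmod x" "cmod y"] by (simp add: power2_sum)
      finally show ?thesis .
    qed
    from this[of "a * deriv f z" "b * deriv g z" for z] show "AE z in lborel. z \<in> unit_disk \<longrightarrow>
        norm ((cmod (deriv ?k z))\<^sup>2) \<le> norm (2 * (cmod a)\<^sup>2 * (cmod (deriv f z))\<^sup>2 + 2 * (cmod b)\<^sup>2 * (cmod (deriv g z))\<^sup>2)"
      using der by (auto simp: norm_mult power_mult_distrib mult_ac simp del: mem_ball mem_ball_0 intro!: AE_I2)
  qed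
  thus ?thesis using holk by (simp add: dirichlet_space_def)
qed

text \<open>By the substitution rule the Dirichlet integral of \<open>f \<circ> g\<close> is the one of \<open>f\<close> over the image of
  \<open>g\<close>. Injectivity matters: without it values would be counted with multiplicity.\<close>
lemma dirichlet_space_compose_injective:
  assumes f: "f \<in> dirichlet_space" and g: "g holomorphic_on unit_disk"
    and maps: "g ` unit_disk \<subseteq> unit_disk" and inj: "inj_on g unit_disk"
  shows "(\<lambda>z. f (g z)) \<in> dirichlet_space"
proof -
  have holf: "f holomorphic_on unit_disk" and intf: "set_integrable lborel unit_disk (\<lambda>z. (cmod (deriv f z))\<^sup>2)"
    using f by (auto simp: dirichlet_space_def)
  have der: "deriv (\<lambda>z. f (g z)) z = deriv f (g z) * deriv g z" if z: "z \<in> unit_disk" for z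
  proof -
    have "(f has_field_derivative deriv f (g z)) (at (g z))"
      using maps z by (intro holomorphic_derivI[OF holf open_ball]) blast
    from DERIV_chain2[OF this holomorphic_derivI[OF g _ z]] show ?thesis
      by (simp add: DERIV_imp_deriv)
  qed
  have og: "open (g ` unit_disk)" by (rule open_mapping_thm3[OF g _ inj]) auto
  have "set_integrable lborel (g ` unit_disk) (\<lambda>z. (cmod (deriv f z))\<^sup>2)"
    by (rule set_integrable_subset[OF intf]) (use maps og in auto)
  moreover have "continuous_on (g ` unit_disk) (\<lambda>z. (cmod (deriv f z))\<^sup>2)"
    using maps by (intro continuous_intros holomorphic_on_imp_continuous_on
        holomorphic_on_subset[OF holomorphic_deriv[OF holf]]) auto
  ultimately have "set_integrable lborel unit_disk (\<lambda>z. (cmod (deriv g z))\<^sup>2 * (cmod (deriv f (g z)))\<^sup>2)"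
    using set_integrable_holomorphic_substitution[OF _ g inj] by blast
  also have "?this \<longleftrightarrow> set_integrable lborel unit_disk (\<lambda>z. (cmod (deriv (\<lambda>z. f (g z)) z))\<^sup>2)"
    by (rule set_integrable_cong) (auto simp: der norm_mult power_mult_distrib)
  finally show ?thesis
    using holomorphic_on_compose_gen[OF g holf] maps by (auto simp: dirichlet_space_def o_def)
qed

section \<open>The eigenfunctions of the generator\<close>

locale koenigs_semigroup =
  fixes \<phi> :: "real \<Rightarrow> complex \<Rightarrow> complex" and h :: "complex \<Rightarrow> complex"
  assumes semigroup: "holo_semigroup \<phi>" and koenigs: "koenigs_function \<phi> h"
begin

lemma holomorphic_koenigs: "h holomorphic_on unit_disk"
  and injective_koenigs: "inj_on h unit_disk"
  using koenigs by (auto simp: koenigs_function_def)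

lemma koenigs_semigroup_eq: "t \<ge> 0 \<Longrightarrow> z \<in> unit_disk \<Longrightarrow> h (\<phi> t z) = h z + of_real t"
  using koenigs by (auto simp: koenigs_function_def)

lemma holomorphic_semigroup: "t \<ge> 0 \<Longrightarrow> \<phi> t holomorphic_on unit_disk"
  and semigroup_maps: "t \<ge> 0 \<Longrightarrow> \<phi> t ` unit_disk \<subseteq> unit_disk"
  using semigroup by (auto simp: holo_semigroup_def)

lemma injective_semigroup: "t \<ge> 0 \<Longrightarrow> inj_on (\<phi> t) unit_disk"
proof (rule inj_onI)
  fix z w assume t: "t \<ge> 0" and zw: "z \<in> unit_disk" "w \<in> unit_disk" and "\<phi> t z = \<phi> t w"
  hence "h z = h w" using koenigs_semigroup_eq[OF t] by (metis add_right_cancel)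
  thus "z = w" using injective_koenigs zw by (auto simp: inj_on_def)
qed

lemma open_koenigs_domain: "open (h ` unit_disk)"
  by (rule open_mapping_thm3[OF holomorphic_koenigs _ injective_koenigs]) auto

lemma connected_koenigs_domain: "connected (h ` unit_disk)"
  by (intro connected_continuous_image holomorphic_on_imp_continuous_on holomorphic_koenigs) auto

lemma koenigs_domain_translate:
  assumes "t \<ge> 0" "w \<in> h ` unit_disk" shows "w + of_real t \<in> h ` unit_disk"
  using assms koenigs_semigroup_eq semigroup_maps by (metis image_iff image_subset_iff)

text \<open>In the Koenigs coordinate \<open>w = h z\<close> the semigroup is translation by \<open>t\<close>, so its generator is
  \<open>d/dw\<close>, and an eigenfunction is a multiple of \<open>exp (\<mu> * w)\<close>. Write \<open>f = F \<circ> h\<close>. The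
  norm limit that defines the generator controls derivatives in \<open>L\<^sup>2\<close> and the value at the origin. The former give
  \<open>F'' = \<mu> * F'\<close> on the Koenigs domain, the latter gives \<open>F' = \<mu> * F\<close> at the single point \<open>h 0\<close>;
  since the domain is connected, \<open>F' = \<mu> * F\<close> holds throughout.\<close>
lemma eigenfunction_is_exponential:
  assumes gen: "dirichlet_generator \<phi> f (\<lambda>z. \<mu> * f z)"
  obtains c where "\<And>z. z \<in> unit_disk \<Longrightarrow> f z = c * exp (\<mu> * h z)"
proof -
  let ?D = "unit_disk" and ?\<Omega> = "h ` unit_disk"
  have fD: "f \<in> dirichlet_space" using gen by (simp add: dirichlet_generator_def)
  hence holf: "f holomorphic_on ?D" by (simp add: dirichlet_space_def)
  obtain k where holk: "k holomorphic_on ?\<Omega>" and kh: "\<And>z. z \<in> ?D \<Longrightarrow> k (h z) = z"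
    using holomorphic_has_inverse[OF holomorphic_koenigs _ injective_koenigs] by (metis open_ball)
  define F where "F = (\<lambda>w. f (k w))"
  have holF: "F holomorphic_on ?\<Omega>"
    using holomorphic_on_compose_gen[OF holk holf] kh by (force simp: F_def o_def)
  have fF: "f z = F (h z)" if "z \<in> ?D" for z using kh[OF that] by (simp add: F_def)
  have dF: "(F has_field_derivative deriv F w) (at w)"
    and ddF: "(deriv F has_field_derivative deriv (deriv F) w) (at w)" if "w \<in> ?\<Omega>" for w
    using holomorphic_derivI[OF holF open_koenigs_domain that]
      holomorphic_derivI[OF holomorphic_deriv[OF holF open_koenigs_domain] open_koenigs_domain that]
    by auto
  define t where "t n = inverse (real (Suc n))" for n
  have tpos: "t n > 0" for n by (simp add: t_def)
  have tne: "t n \<noteq> 0" for n using tpos[of n] by simp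
  have t0: "t \<longlonglongrightarrow> 0" unfolding t_def by (rule LIMSEQ_inverse_real_of_nat)
  hence tright: "filterlim t (at_right 0) sequentially"
    using tpos tne by (simp add: filterlim_at)
  \<comment> \<open>The quotients \<open>g n\<close> on the disk are the quotients \<open>G n\<close> read in the Koenigs coordinate, and \<open>G' n\<close> is the derivative of \<open>G n\<close>.\<close>
  define g where "g n z = (f (\<phi> (t n) z) - f z) / of_real (t n) - \<mu> * f z" for n z
  define G where "G n w = (F (w + of_real (t n)) - F w) / of_real (t n) - \<mu> * F w" for n w
  define G' where "G' n w = (deriv F (w + of_real (t n)) - deriv F w) / of_real (t n) - \<mu> * deriv F w" for n w
  have gG: "g n z = G n (h z)" if z: "z \<in> ?D" for n z
  proof -
    have "\<phi> (t n) z \<in> ?D" using semigroup_maps[of "t n"] less_imp_le[OF tpos] z by blast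
    thus ?thesis
      using koenigs_semigroup_eq[of "t n" z] tpos[of n] z by (simp add: g_def G_def fF)
  qed
  have dG: "(G n has_field_derivative G' n w) (at w)" if w: "w \<in> ?\<Omega>" for n w
  proof -
    have w': "w + of_real (t n) \<in> ?\<Omega>"
      using koenigs_domain_translate[of "t n" w] tpos[of n] w by auto
    have "((\<lambda>w. F (w + of_real (t n))) has_field_derivative deriv F (w + of_real (t n))) (at w)"
      using dF[OF w'] by (subst (asm) DERIV_shift)
    thus ?thesis
      unfolding G_def G'_def by (auto intro!: derivative_eq_intros dF[OF w] simp: tne)
  qed
  have dg: "deriv (g n) z = deriv h z * G' n (h z)" if z: "z \<in> ?D" for n z
  proof (rule DERIV_imp_deriv)
    have "((\<lambda>z. G n (h z)) has_field_derivative G' n (h z) * deriv h z) (at z)"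
      by (rule DERIV_chain2[OF dG holomorphic_derivI[OF holomorphic_koenigs _ z]]) (use z in auto)
    hence "(g n has_field_derivative G' n (h z) * deriv h z) (at z)"
      by (rule has_field_derivative_transform_within_open[of _ _ _ ?D]) (use z gG in auto)
    thus "(g n has_field_derivative deriv h z * G' n (h z)) (at z)" by (simp add: mult.commute)
  qed
  have gD: "g n \<in> dirichlet_space" for n
  proof -
    have "(\<lambda>z. f (\<phi> (t n) z)) \<in> dirichlet_space"
      using dirichlet_space_compose_injective[OF fD holomorphic_semigroup semigroup_maps
          injective_semigroup] less_imp_le[OF tpos] by blast
    from dirichlet_space_linear_combination[OF this fD, of "1 / of_real (t n)" "- 1 / of_real (t n) - \<mu>"]
    show ?thesis unfolding g_def by (simp add: diff_divide_distrib algebra_simps)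
  qed
  \<comment> \<open>Membership in the space is what makes the integral \<open>I n\<close> genuine: a divergent Lebesgue integral would be assigned the value zero.\<close>
  define I where "I n = (LINT z:?D|lborel. (cmod (deriv (g n) z))\<^sup>2)" for n
  have Inonneg: "I n \<ge> 0" for n
    unfolding I_def set_lebesgue_integral_def by (intro integral_nonneg_AE) auto
  have "(\<lambda>n. dirichlet_norm (g n)) \<longlonglongrightarrow> 0"
    using filterlim_compose[OF _ tright] gen
    unfolding dirichlet_generator_def g_def composition_op_def o_def by blast
  hence "(\<lambda>n. (dirichlet_norm (g n))\<^sup>2) \<longlonglongrightarrow> 0" by (auto intro: tendsto_eq_intros)
  moreover have "(dirichlet_norm (g n))\<^sup>2 = (cmod (g n 0))\<^sup>2 + I n / pi" for n
    using Inonneg[of n] by (simp add: dirichlet_norm_def I_def)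
  ultimately have sq: "(\<lambda>n. (cmod (g n 0))\<^sup>2 + I n / pi) \<longlonglongrightarrow> 0" by simp
  have "(\<lambda>n. I n / pi) \<longlonglongrightarrow> 0"
    by (rule tendsto_sandwich[OF _ _ tendsto_const sq]) (use Inonneg in auto)
  from tendsto_mult_left[OF this, of pi] have I0: "I \<longlonglongrightarrow> 0" by simp
  have "(\<lambda>n. (cmod (g n 0))\<^sup>2) \<longlonglongrightarrow> 0"
    by (rule tendsto_sandwich[OF _ _ tendsto_const sq]) (use Inonneg in auto)
  hence g0: "(\<lambda>n. g n 0) \<longlonglongrightarrow> 0"
    using tendsto_real_sqrt[of "\<lambda>n. (cmod (g n 0))\<^sup>2" 0] by (simp add: tendsto_norm_zero_iff)
  have diffquot: "(\<lambda>n. (H (w + of_real (t n)) - H w) / of_real (t n)) \<longlonglongrightarrow> D"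
    if "(H has_field_derivative D) (at w)" for H w and D :: complex
  proof -
    have "filterlim (\<lambda>n. complex_of_real (t n)) (at 0) sequentially"
      using tendsto_of_real[OF t0, where 'a = complex] tne by (simp add: filterlim_at)
    from filterlim_compose[OF that[unfolded DERIV_def] this] show ?thesis .
  qed
  have second: "deriv (deriv F) w - \<mu> * deriv F w = 0" if w: "w \<in> ?\<Omega>" for w
  proof -
    obtain z where z: "z \<in> ?D" "w = h z" using w by auto
    have "deriv h z * (deriv (deriv F) (h z) - \<mu> * deriv F (h z)) = 0"
    proof (rule L2_limit_zero_imp_pointwise_limit_zero[where U = ?D and f = "\<lambda>n. deriv (g n)"
          and g = "\<lambda>z. deriv h z * (deriv (deriv F) (h z) - \<mu> * deriv F (h z))"])
      show "continuous_on ?D (deriv (g n))" for n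
        using gD[of n] by (auto simp: dirichlet_space_def intro!: holomorphic_on_imp_continuous_on holomorphic_deriv)
      have "(\<lambda>w. deriv (deriv F) w - \<mu> * deriv F w) holomorphic_on ?\<Omega>"
        by (intro holomorphic_intros holomorphic_deriv holF open_koenigs_domain)
      from holomorphic_on_compose_gen[OF holomorphic_koenigs this]
      show "continuous_on ?D (\<lambda>z. deriv h z * (deriv (deriv F) (h z) - \<mu> * deriv F (h z)))"
        by (intro continuous_on_mult holomorphic_on_imp_continuous_on holomorphic_deriv holomorphic_koenigs)
          (auto simp: o_def)
      show "set_integrable lborel ?D (\<lambda>z. (cmod (deriv (g n) z))\<^sup>2)" for n
        using gD[of n] by (auto simp: dirichlet_space_def)
      show "(\<lambda>n. LINT z:?D|lborel. (cmod (deriv (g n) z))\<^sup>2) \<longlonglongrightarrow> 0"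
        using I0 by (simp add: I_def[abs_def])
      show "(\<lambda>n. deriv (g n) y) \<longlonglongrightarrow> deriv h y * (deriv (deriv F) (h y) - \<mu> * deriv F (h y))"
        if y: "y \<in> ?D" for y
        unfolding dg[OF y] G'_def
        by (intro tendsto_intros diffquot ddF) (use y in auto)
    qed (use z in auto)
    moreover have "deriv h z \<noteq> 0"
      using holomorphic_injective_imp_regular[OF holomorphic_koenigs _ injective_koenigs] z by auto
    ultimately show ?thesis using z by simp
  qed
  have h0: "h 0 \<in> ?\<Omega>" by auto
  have first0: "deriv F (h 0) - \<mu> * F (h 0) = 0"
  proof (rule LIMSEQ_unique)
    show "(\<lambda>n. g n 0) \<longlonglongrightarrow> deriv F (h 0) - \<mu> * F (h 0)"
      unfolding gG[of 0, simplified] G_def by (intro tendsto_intros diffquot dF h0)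
  qed fact
  have first: "deriv F w - \<mu> * F w = 0" if w: "w \<in> ?\<Omega>" for w
  proof -
    have der: "((\<lambda>w. deriv F w - \<mu> * F w) has_field_derivative 0) (at w)" if "w \<in> ?\<Omega>" for w
      using second[OF that] by (auto intro!: derivative_eq_intros ddF dF that)
    have "(\<lambda>w. deriv F w - \<mu> * F w) constant_on ?\<Omega>"
      by (rule has_field_derivative_0_imp_constant_on[OF der connected_koenigs_domain open_koenigs_domain])
    thus ?thesis using first0 h0 w unfolding constant_on_def by metis
  qed
  \<comment> \<open>\<open>F' = \<mu> * F\<close> is solved by an integrating factor.\<close>
  have der: "((\<lambda>w. F w * exp (- \<mu> * w)) has_field_derivative 0) (at w)" if "w \<in> ?\<Omega>" for w
    using first[OF that] by (auto intro!: derivative_eq_intros dF that simp: algebra_simps)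
  have "(\<lambda>w. F w * exp (- \<mu> * w)) constant_on ?\<Omega>"
    by (rule has_field_derivative_0_imp_constant_on[OF der connected_koenigs_domain open_koenigs_domain])
  then obtain c where c: "\<And>w. w \<in> ?\<Omega> \<Longrightarrow> F w * exp (- \<mu> * w) = c"
    unfolding constant_on_def by blast
  have "f z = c * exp (\<mu> * h z)" if "z \<in> ?D" for z
  proof -
    have "F (h z) * exp (- \<mu> * h z) = c" using c that by blast
    thus ?thesis using fF[OF that] by (auto simp: exp_minus field_simps)
  qed
  thus ?thesis by (rule that)
qed

text \<open>The Dirichlet integral of \<open>exp \<circ> (\<lambda>w. \<mu> * w) \<circ> h\<close> over the disk is that of
  \<open>\<lambda>w. exp (\<mu> * w)\<close> over the Koenigs domain, where the squared modulus
  of the derivative is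
  \<open>(cmod \<mu>)\<^sup>2 * exp (2 * Re (\<mu> * w))\<close>.\<close>
lemma exponential_in_dirichlet_space_iff:
  "(\<lambda>z. exp (\<mu> * h z)) \<in> dirichlet_space \<longleftrightarrow>
     \<mu> = 0 \<or> set_integrable lborel (h ` unit_disk) (\<lambda>w. exp (2 * Re (\<mu> * w)))"
proof -
  let ?D = "unit_disk"
  have hol: "(\<lambda>z. exp (\<mu> * h z)) holomorphic_on ?D"
    by (intro holomorphic_intros holomorphic_koenigs)
  have der: "deriv (\<lambda>z. exp (\<mu> * h z)) z = \<mu> * (deriv h z * exp (\<mu> * h z))" if "z \<in> ?D" for z
    by (rule DERIV_imp_deriv) (auto intro!: derivative_eq_intros holomorphic_derivI[OF holomorphic_koenigs _ that])
  have "set_integrable lborel ?D (\<lambda>z. (cmod (deriv (\<lambda>z. exp (\<mu> * h z)) z))\<^sup>2) \<longleftrightarrow>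
      set_integrable lborel ?D (\<lambda>z. (cmod \<mu>)\<^sup>2 * ((cmod (deriv h z))\<^sup>2 * exp (2 * Re (\<mu> * h z))))"
    by (rule set_integrable_cong)
      (auto simp: der norm_mult power_mult_distrib exp_double simp del: times_complex.simps)
  also have "\<dots> \<longleftrightarrow> \<mu> = 0 \<or> set_integrable lborel ?D (\<lambda>z. (cmod (deriv h z))\<^sup>2 * exp (2 * Re (\<mu> * h z)))"
  proof (cases "\<mu> = 0")
    case False
    hence "(cmod \<mu>)\<^sup>2 \<noteq> 0" by simp
    with False show ?thesis
      by (simp only: set_integrable_mult_right_iff[OF \<open>(cmod \<mu>)\<^sup>2 \<noteq> 0\<close>] simp_thms)
  qed (simp add: set_integrable_def)
  also have "set_integrable lborel ?D (\<lambda>z. (cmod (deriv h z))\<^sup>2 * exp (2 * Re (\<mu> * h z))) \<longleftrightarrow>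
      set_integrable lborel (h ` ?D) (\<lambda>w. exp (2 * Re (\<mu> * w)))"
    by (rule set_integrable_holomorphic_substitution[symmetric, OF _ holomorphic_koenigs injective_koenigs])
      (auto intro!: continuous_intros)
  finally show ?thesis using hol by (simp add: dirichlet_space_def)
qed

text \<open>The eigenfunctions being known, only their membership in the space is at stake; conversely,
  for an exponential in the space the difference quotient is the eigenfunction times the scalar
  \<open>(exp (\<mu> * t) - 1) / t\<close>, so the norm limit is a scalar limit.\<close>
theorem dirichlet_point_spectrum_iff:
  "\<mu> \<in> dirichlet_point_spectrum \<phi> \<longleftrightarrow>
     \<mu> = 0 \<or> set_integrable lborel (h ` unit_disk) (\<lambda>w. exp (2 * Re (\<mu> * w)))"
proof -
  have "\<mu> \<in> dirichlet_point_spectrum \<phi> \<longleftrightarrow> (\<lambda>z. exp (\<mu> * h z)) \<in> dirichlet_space"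
  proof
    assume "\<mu> \<in> dirichlet_point_spectrum \<phi>"
    then obtain f z0 where z0: "z0 \<in> unit_disk" "f z0 \<noteq> 0"
      and gen: "dirichlet_generator \<phi> f (\<lambda>z. \<mu> * f z)"
      by (auto simp: dirichlet_point_spectrum_def)
    obtain c where c: "\<And>z. z \<in> unit_disk \<Longrightarrow> f z = c * exp (\<mu> * h z)"
      using eigenfunction_is_exponential[OF gen] by blast
    have [simp]: "c \<noteq> 0" using z0 c by auto
    have fD: "f \<in> dirichlet_space" using gen by (simp add: dirichlet_generator_def)
    have gD: "(\<lambda>z. 1 / c * f z + 0 * f z) \<in> dirichlet_space"
      using dirichlet_space_linear_combination[OF fD fD] .
    have "deriv (\<lambda>z. 1 / c * f z + 0 * f z) z = deriv (\<lambda>z. exp (\<mu> * h z)) z" if "z \<in> unit_disk" for z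
    proof (rule complex_derivative_transform_within_open)
      show "(\<lambda>z. exp (\<mu> * h z)) holomorphic_on unit_disk"
        by (intro holomorphic_intros holomorphic_koenigs)
      show "(\<lambda>z. 1 / c * f z + 0 * f z) holomorphic_on unit_disk"
        using gD by (simp add: dirichlet_space_def)
    qed (use that c in auto)
    hence "set_integrable lborel unit_disk (\<lambda>z. (cmod (deriv (\<lambda>z. exp (\<mu> * h z)) z))\<^sup>2)"
      using gD set_integrable_cong[OF refl refl, of unit_disk
          "\<lambda>z. (cmod (deriv (\<lambda>z. exp (\<mu> * h z)) z))\<^sup>2"
          "\<lambda>z. (cmod (deriv (\<lambda>z. 1 / c * f z + 0 * f z) z))\<^sup>2" lborel]
      unfolding dirichlet_space_def mem_Collect_eq by presburger
    thus "(\<lambda>z. exp (\<mu> * h z)) \<in> dirichlet_space"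
      by (auto simp: dirichlet_space_def intro!: holomorphic_intros holomorphic_koenigs)
  next
    assume D: "(\<lambda>z. exp (\<mu> * h z)) \<in> dirichlet_space"
    let ?f = "\<lambda>z. exp (\<mu> * h z)"
    let ?r = "\<lambda>t. (exp (\<mu> * of_real t) - 1) / of_real t - \<mu>"
    have muD: "(\<lambda>z. \<mu> * ?f z) \<in> dirichlet_space"
      using dirichlet_space_linear_combination[OF D D, of \<mu> 0] by simp
    have norm_mult: "dirichlet_norm (\<lambda>z. (composition_op \<phi> t ?f z - ?f z) / of_real t - \<mu> * ?f z) =
        cmod (?r t) * dirichlet_norm ?f" if t: "t > 0" for t
    proof -
      let ?g = "\<lambda>z. (composition_op \<phi> t ?f z - ?f z) / of_real t - \<mu> * ?f z"
      have g: "?g z = ?r t * ?f z" if "z \<in> unit_disk" for z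
        using koenigs_semigroup_eq[of t z] t that
        by (simp add: composition_op_def field_simps exp_add)
      have dg: "deriv ?g z = ?r t * deriv ?f z" if z: "z \<in> unit_disk" for z
      proof (rule DERIV_imp_deriv)
        have "(?f has_field_derivative deriv ?f z) (at z)"
          by (rule holomorphic_derivI[OF _ _ z]) (auto intro!: holomorphic_intros holomorphic_koenigs)
        from DERIV_cmult[OF this]
        have "((\<lambda>z. ?r t * ?f z) has_field_derivative ?r t * deriv ?f z) (at z)" .
        thus "(?g has_field_derivative ?r t * deriv ?f z) (at z)"
          by (rule has_field_derivative_transform_within_open[of _ _ _ unit_disk]) (use z g in auto)
      qed
      have "(LINT z:unit_disk|lborel. (cmod (deriv ?g z))\<^sup>2) =
          (LINT z:unit_disk|lborel. (cmod (?r t))\<^sup>2 * (cmod (deriv ?f z))\<^sup>2)"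
        by (rule set_lebesgue_integral_cong)
          (auto simp: dg norm_mult power_mult_distrib)
      also have "\<dots> = (cmod (?r t))\<^sup>2 * (LINT z:unit_disk|lborel. (cmod (deriv ?f z))\<^sup>2)"
        by (rule set_integral_mult_right)
      finally have *: "(LINT z:unit_disk|lborel. (cmod (deriv ?g z))\<^sup>2) = \<dots>" .
      have "(cmod (?g 0))\<^sup>2 + (LINT z:unit_disk|lborel. (cmod (deriv ?g z))\<^sup>2) / pi =
         (cmod (?r t))\<^sup>2 * ((cmod (?f 0))\<^sup>2 + (LINT z:unit_disk|lborel. (cmod (deriv ?f z))\<^sup>2) / pi)"
        unfolding * using g[of 0] by (simp add: norm_mult power_mult_distrib distrib_left)
      thus ?thesis unfolding dirichlet_norm_def by (simp add: real_sqrt_mult)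
    qed
    have "((\<lambda>x. exp (\<mu> * x)) has_field_derivative \<mu>) (at 0)"
      by (auto intro!: derivative_eq_intros)
    hence "((\<lambda>x. (exp (\<mu> * x) - 1) / x) \<longlongrightarrow> \<mu>) (at 0)" by (simp add: DERIV_def)
    moreover have "filterlim complex_of_real (at 0) (at_right 0)"
      by (auto simp: filterlim_at eventually_at_filter intro!: tendsto_eq_intros)
    ultimately have "((\<lambda>t. (exp (\<mu> * of_real t) - 1) / of_real t) \<longlongrightarrow> \<mu>) (at_right (0::real))"
      by (rule filterlim_compose)
    hence "((\<lambda>t. cmod (?r t) * dirichlet_norm ?f) \<longlongrightarrow> cmod (\<mu> - \<mu>) * dirichlet_norm ?f) (at_right 0)"
      by (intro tendsto_intros)
    hence "((\<lambda>t. dirichlet_norm (\<lambda>z. (composition_op \<phi> t ?f z - ?f z) / of_real t - \<mu> * ?f z)) \<longlongrightarrow> 0) (at_right 0)"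
      by (subst filterlim_cong[OF refl refl, where g = "\<lambda>t. cmod (?r t) * dirichlet_norm ?f"])
        (auto simp: eventually_at_filter norm_mult intro!: always_eventually)
    hence "dirichlet_generator \<phi> ?f (\<lambda>z. \<mu> * ?f z)"
      using D muD by (simp add: dirichlet_generator_def)
    moreover have "?f 0 \<noteq> 0" by simp
    ultimately show "\<mu> \<in> dirichlet_point_spectrum \<phi>"
      unfolding dirichlet_point_spectrum_def
      by (intro CollectI exI[of _ ?f] conjI bexI[of _ 0]) simp_all
  qed
  thus ?thesis by (simp add: exponential_in_dirichlet_space_iff)
qed

end

section \<open>Integrability of exponentials over planar domains\<close>

abbreviation exp_weight :: "complex \<Rightarrow> complex \<Rightarrow> real" where
  "exp_weight \<mu> w \<equiv> exp (2 * Re (\<mu> * w))"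

text \<open>Markov's inequality. It bounds the area of every part of \<open>\<Omega>\<close> on which the weight does not
  become small, and both necessary conditions below come from exhibiting such parts of
  arbitrarily large area.\<close>
lemma measure_le_integral_exp_weight:
  assumes int: "set_integrable lborel \<Omega> (exp_weight \<mu>)"
    and S: "S \<in> sets lborel" "S \<subseteq> \<Omega>" and c: "\<And>w. w \<in> S \<Longrightarrow> c \<le> Re (\<mu> * w)"
  shows "measure lborel S * exp (2 * c) \<le> (LINT w:\<Omega>|lborel. exp_weight \<mu> w)"
proof -
  have intS: "set_integrable lborel S (exp_weight \<mu>)" by (rule set_integrable_subset[OF int S])
  hence const: "set_integrable lborel S (\<lambda>w. exp (2 * c))"
    by (rule set_integrable_bound) (use c S in \<open>auto simp: set_borel_measurable_def simp del: times_complex.simps\<close>)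
  hence "set_integrable lborel S (\<lambda>w. 1 :: real)"
    using set_integrable_mult_right_iff[of "exp (2 * c)" lborel S "\<lambda>_. 1"] by simp
  hence fin: "emeasure lborel S < \<infinity>"
    using S by (simp add: set_integrable_def integrable_indicator_iff)
  have "measure lborel S * exp (2 * c) = (LINT w:S|lborel. exp (2 * c))"
    using S fin by (subst set_integral_const) auto
  also have "\<dots> \<le> (LINT w:S|lborel. exp_weight \<mu> w)"
    by (rule set_integral_mono[OF const intS]) (use c in \<open>simp del: times_complex.simps\<close>)
  also have "\<dots> \<le> (LINT w:\<Omega>|lborel. exp_weight \<mu> w)"
    unfolding set_lebesgue_integral_def
    by (rule integral_mono) (use intS int S in \<open>auto simp: set_integrable_def indicator_def\<close>)
  finally show "measure lborel S * exp (2 * c) \<le> (LINT w:\<Omega>|lborel. exp_weight \<mu> w)" .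
qed

lemma measure_complex_box:
  assumes "a \<le> b" "c \<le> d"
  shows "measure lborel (cbox (Complex a c) (Complex b d)) = (b - a) * (d - c)"
  using assms by (subst content_cbox') (auto simp: Basis_complex_def box_eq_empty complex_eq_iff)

text \<open>An open set that is invariant under translation to the right contains a horizontal half-strip. If
  \<open>Re \<mu> \<ge> 0\<close>, the weight is bounded below on it, although its area is infinite.\<close>
lemma integrable_exp_weight_imp_Re_neg:
  assumes op: "open \<Omega>" and ne: "\<Omega> \<noteq> {}"
    and trans: "\<And>t w. t \<ge> 0 \<Longrightarrow> w \<in> \<Omega> \<Longrightarrow> w + of_real t \<in> \<Omega>"
    and int: "set_integrable lborel \<Omega> (exp_weight \<mu>)"
  shows "Re \<mu> < 0"
proof (rule ccontr)
  assume "\<not> Re \<mu> < 0"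
  hence mu: "Re \<mu> \<ge> 0" by simp
  obtain w where w: "w \<in> \<Omega>" using ne by auto
  then obtain r where r: "r > 0" "cball w r \<subseteq> \<Omega>" using op open_contains_cball by blast
  define c where "c = Re (\<mu> * w) - cmod \<mu> * r"
  define I where "I = (LINT w:\<Omega>|lborel. exp_weight \<mu> w)"
  \<comment> \<open>The rectangle \<open>S\<close> is covered by translates of the vertical diameter of the disk \<open>cball w r\<close>.\<close>
  have bound: "2 * r * N * exp (2 * c) \<le> I" if N: "N \<ge> 0" for N
  proof -
    define S where "S = cbox (Complex (Re w) (Im w - r)) (Complex (Re w + N) (Im w + r))"
    have decomp: "\<exists>v t. v \<in> cball w r \<and> t \<ge> 0 \<and> z = v + of_real t" if "z \<in> S" for z
    proof (intro exI conjI)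
      have "dist w (Complex (Re w) (Im z)) = \<bar>Im w - Im z\<bar>"
        by (simp add: dist_norm cmod_def)
      thus "Complex (Re w) (Im z) \<in> cball w r"
        using that by (auto simp: S_def in_cbox_complex_iff)
      show "Re z - Re w \<ge> 0" using that by (auto simp: S_def in_cbox_complex_iff)
      show "z = Complex (Re w) (Im z) + of_real (Re z - Re w)" by (simp add: complex_eq_iff)
    qed
    have "measure lborel S * exp (2 * c) \<le> I"
      unfolding I_def
    proof (rule measure_le_integral_exp_weight[OF int])
      show "S \<in> sets lborel" by (simp add: S_def)
      show "S \<subseteq> \<Omega>" using decomp trans r(2) by blast
      fix z assume "z \<in> S"
      then obtain v t where v: "v \<in> cball w r" "t \<ge> 0" "z = v + of_real t" using decomp by blast
      have "\<bar>Re (\<mu> * (v - w))\<bar> \<le> cmod \<mu> * cmod (v - w)"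
        by (metis abs_Re_le_cmod norm_mult)
      also have "\<dots> \<le> cmod \<mu> * r" using v by (intro mult_left_mono) (auto simp: dist_norm norm_minus_commute)
      finally have "Re (\<mu> * v) \<ge> c" by (simp add: c_def algebra_simps)
      moreover have "Re \<mu> * t \<ge> 0" using mu v by simp
      ultimately show "c \<le> Re (\<mu> * z)" by (simp add: v algebra_simps)
    qed
    also have "measure lborel S = 2 * r * N"
      unfolding S_def using r N by (subst measure_complex_box) auto
    finally show ?thesis .
  qed
  \<comment> \<open>The length \<open>N\<close> is chosen so that the bound reads \<open>\<bar>I\<bar> + 1 \<le> I\<close>.\<close>
  have "2 * r * ((\<bar>I\<bar> + 1) / (2 * r * exp (2 * c))) * exp (2 * c) \<le> I"
    by (rule bound) (use r in auto)
  moreover have "2 * r * ((\<bar>I\<bar> + 1) / (2 * r * exp (2 * c))) * exp (2 * c) = \<bar>I\<bar> + 1"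
    using r by simp
  ultimately show False by linarith
qed

lemma mult_mem_sector:
  assumes "r > 0" "w \<in> sector a b" shows "of_real r * w \<in> sector a b"
  using assms by (auto simp: sector_def)

lemma isCont_Arg_cis:
  assumes "- pi < \<alpha>" "\<alpha> < pi" shows "isCont Arg (cis \<alpha>)"
proof (rule continuous_at_Arg)
  show "cis \<alpha> \<notin> \<real>\<^sub>\<le>\<^sub>0"
    using assms sin_eq_0_pi[of \<alpha>] by (auto simp: complex_nonpos_Reals_iff)
qed

lemma cis_mem_interior_sector:
  assumes "- pi \<le> a" "b \<le> pi" "\<alpha> \<in> {a<..<b}"
  obtains e where "e > 0" "ball (cis \<alpha>) e \<subseteq> sector a b"
proof -
  have arg: "Arg (cis \<alpha>) = \<alpha>" using assms by (intro Arg_cis) auto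
  have "isCont Arg (cis \<alpha>)" using assms by (intro isCont_Arg_cis) auto
  hence "(Arg \<longlongrightarrow> Arg (cis \<alpha>)) (nhds (cis \<alpha>))"
    by (simp add: isCont_def tendsto_at_iff_tendsto_nhds)
  hence "eventually (\<lambda>w. Arg w > a \<and> Arg w < b) (nhds (cis \<alpha>))"
    using assms arg by (intro eventually_conj order_tendstoD) auto
  moreover have "eventually (\<lambda>w. w \<noteq> 0) (nhds (cis \<alpha>))" by (rule t1_space_nhds) auto
  ultimately have "eventually (\<lambda>w. w \<in> sector a b) (nhds (cis \<alpha>))"
    by eventually_elim (auto simp: sector_def)
  then obtain e where "e > 0" "\<forall>w. dist w (cis \<alpha>) < e \<longrightarrow> w \<in> sector a b"
    by (auto simp: eventually_nhds_metric)
  thus ?thesis by (intro that[of e]) (auto simp: dist_commute)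
qed

text \<open>If \<open>Re (\<mu> * cis \<alpha>) > 0\<close>, then \<open>Re (\<mu> * w)\<close> is positive on an open cone around the ray of direction
  \<open>\<alpha>\<close>. Dilating one disk of that cone yields disks of arbitrarily large radius in \<open>\<Omega>\<close> on which the
  weight exceeds its value at the vertex \<open>q\<close>.\<close>
lemma integrable_exp_weight_imp_Re_nonpos_on_sector:
  assumes ab: "- pi \<le> a" "b \<le> pi" and sub: "(\<lambda>w. q + w) ` sector a b \<subseteq> \<Omega>"
    and int: "set_integrable lborel \<Omega> (exp_weight \<mu>)" and \<alpha>: "\<alpha> \<in> {a<..<b}"
  shows "Re (\<mu> * cis \<alpha>) \<le> 0"
proof (rule ccontr)
  assume "\<not> Re (\<mu> * cis \<alpha>) \<le> 0"
  hence pos: "0 < Re (\<mu> * cis \<alpha>)" by simp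
  obtain e where e: "e > 0" "ball (cis \<alpha>) e \<subseteq> sector a b"
    using cis_mem_interior_sector[OF ab \<alpha>] .
  have "eventually (\<lambda>w. 0 < Re (\<mu> * w)) (nhds (cis \<alpha>))"
    by (rule order_tendstoD(1)[OF _ pos]) (intro tendsto_intros filterlim_ident)
  then obtain d where d: "d > 0" "\<And>w. dist w (cis \<alpha>) < d \<Longrightarrow> 0 < Re (\<mu> * w)"
    by (auto simp: eventually_nhds_metric)
  define m where "m = min e d"
  have m: "m > 0" using e d by (simp add: m_def)
  define I where "I = (LINT w:\<Omega>|lborel. exp_weight \<mu> w)"
  have bound: "pi * (R * m)\<^sup>2 * exp (2 * Re (\<mu> * q)) \<le> I" if R: "R > 0" for R
  proof -
    define S where "S = ball (q + of_real R * cis \<alpha>) (R * m)"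
    have decomp: "\<exists>v \<in> ball (cis \<alpha>) m. z = q + of_real R * v" if "z \<in> S" for z
    proof (rule bexI)
      show "z = q + of_real R * ((z - q) / of_real R)" using R by simp
      have "(z - q) / of_real R - cis \<alpha> = (z - (q + of_real R * cis \<alpha>)) / of_real R"
        using R by (simp add: field_simps)
      hence "cmod ((z - q) / of_real R - cis \<alpha>) = cmod (z - (q + of_real R * cis \<alpha>)) / R"
        using R by (simp add: norm_divide)
      also have "\<dots> < m" using that R
        by (simp add: S_def dist_norm norm_minus_commute field_simps)
      finally show "(z - q) / of_real R \<in> ball (cis \<alpha>) m" by (simp add: dist_norm norm_minus_commute)
    qed
    have "measure lborel S * exp (2 * Re (\<mu> * q)) \<le> I"
      unfolding I_def
    proof (rule measure_le_integral_exp_weight[OF int])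
      show "S \<in> sets lborel" by (simp add: S_def)
      show "S \<subseteq> \<Omega>"
      proof
        fix z assume "z \<in> S"
        then obtain v where "v \<in> ball (cis \<alpha>) m" "z = q + of_real R * v" using decomp by blast
        moreover from this have "v \<in> sector a b" using e by (auto simp: m_def)
        ultimately show "z \<in> \<Omega>" using mult_mem_sector[OF R] sub by blast
      qed
      fix z assume "z \<in> S"
      then obtain v where v: "v \<in> ball (cis \<alpha>) m" "z = q + of_real R * v" using decomp by blast
      have "0 < Re (\<mu> * v)" using v by (intro d) (auto simp: m_def dist_commute)
      hence "0 < R * Re (\<mu> * v)" using R by simp
      also have "R * Re (\<mu> * v) = Re (\<mu> * (of_real R * v))" by (simp add: algebra_simps)
      finally show "Re (\<mu> * q) \<le> Re (\<mu> * z)" by (simp add: v distrib_left del: times_complex.simps)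
    qed
    also have "measure lborel S = pi * (R * m)\<^sup>2"
      unfolding S_def using R m by (subst content_ball) (auto simp: unit_ball_vol_2)
    finally show ?thesis .
  qed
  \<comment> \<open>The radius \<open>R\<close> is chosen so that the bound reads \<open>\<bar>I\<bar> + 1 \<le> I\<close>.\<close>
  define C where "C = pi * exp (2 * Re (\<mu> * q))"
  have C: "C > 0" by (simp add: C_def)
  have "pi * (sqrt ((\<bar>I\<bar> + 1) / C) / m * m)\<^sup>2 * exp (2 * Re (\<mu> * q)) \<le> I"
    by (rule bound) (use m C in \<open>auto intro!: divide_pos_pos\<close>)
  moreover have "pi * (sqrt ((\<bar>I\<bar> + 1) / C) / m * m)\<^sup>2 * exp (2 * Re (\<mu> * q)) = \<bar>I\<bar> + 1"
  proof -
    have "(sqrt ((\<bar>I\<bar> + 1) / C) / m * m)\<^sup>2 = (\<bar>I\<bar> + 1) / C" using m C by simp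
    thus ?thesis using C by (simp add: C_def field_simps)
  qed
  ultimately show False by linarith
qed

text \<open>On the annulus \<open>n \<le> cmod (w - q) \<le> n + 1\<close> the integrand is at most \<open>exp (- d * n)\<close>, and the annulus
  lies in a disk whose area is quadratic in \<open>n\<close>; the resulting series converges.\<close>
lemma integrable_exp_minus_norm:
  fixes q :: complex
  assumes d: "d > 0"
  shows "integrable lborel (\<lambda>w. exp (- d * cmod (w - q)))"
proof (rule integrableI_bounded)
  define u where "u n w = ennreal (exp (- d * real n)) * indicator (cball q (real (Suc n))) w" for n w
  have [measurable]: "u n \<in> borel_measurable lborel" for n
    unfolding u_def by (intro borel_measurable_times_ennreal borel_measurable_indicator) auto
  have le: "ennreal (norm (exp (- d * cmod (w - q)))) \<le> (\<Sum>n. u n w)" for w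
  proof -
    define n where "n = nat \<lfloor>cmod (w - q)\<rfloor>"
    have n: "real n \<le> cmod (w - q)" "cmod (w - q) \<le> real (Suc n)"
      unfolding n_def using norm_ge_zero[of "w - q"] by linarith+
    have "ennreal (norm (exp (- d * cmod (w - q)))) \<le> u n w"
      using n d by (auto simp: u_def indicator_def dist_norm norm_minus_commute intro!: ennreal_leI)
    also have "\<dots> = (\<Sum>k\<in>{n}. u k w)" by simp
    also have "\<dots> \<le> (\<Sum>n. u n w)" by (rule sum_le_suminf) auto
    finally show ?thesis .
  qed
  have summ: "summable (\<lambda>n. exp (- d * real n) * (pi * (real (Suc n))\<^sup>2))"
  proof -
    have "summable (\<lambda>n. exp (- d / 2) ^ n)" using d by (intro summable_geometric) auto
    hence "summable (\<lambda>n. norm (exp (- d / 2) ^ n))" by simp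
    moreover have "(\<lambda>n. exp (- d * real n) * (pi * (real (Suc n))\<^sup>2)) \<in> O(\<lambda>n. exp (- d / 2) ^ n)"
      unfolding exp_of_nat_mult[symmetric] using d by real_asymp
    ultimately show ?thesis by (rule summable_comparison_test_bigo)
  qed
  have "(\<integral>\<^sup>+w. ennreal (norm (exp (- d * cmod (w - q)))) \<partial>lborel) \<le> (\<integral>\<^sup>+w. (\<Sum>n. u n w) \<partial>lborel)"
    by (intro nn_integral_mono le)
  also have "\<dots> = (\<Sum>n. \<integral>\<^sup>+w. u n w \<partial>lborel)"
    by (rule nn_integral_suminf) measurable
  also have "\<dots> = (\<Sum>n. ennreal (exp (- d * real n) * (pi * (real (Suc n))\<^sup>2)))"
  proof (intro suminf_cong)
    fix n
    have "(\<integral>\<^sup>+w. u n w \<partial>lborel) = ennreal (exp (- d * real n)) * emeasure lborel (cball q (real (Suc n)))"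
      unfolding u_def by (subst nn_integral_cmult) (auto intro!: borel_measurable_indicator)
    also have "emeasure lborel (cball q (real (Suc n))) = ennreal (pi * (real (Suc n))\<^sup>2)"
      by (subst emeasure_cball) (auto simp: unit_ball_vol_2)
    finally show "(\<integral>\<^sup>+w. u n w \<partial>lborel) = ennreal (exp (- d * real n) * (pi * (real (Suc n))\<^sup>2))"
      by (simp add: ennreal_mult')
  qed
  also have "\<dots> < \<infinity>"
    by (subst suminf_ennreal2[OF _ summ]) auto
  finally show "(\<integral>\<^sup>+w. ennreal (norm (exp (- d * cmod (w - q)))) \<partial>lborel) < \<infinity>" .
qed auto

text \<open>The hypothesis includes the boundary directions \<open>a\<close> and \<open>b\<close>: by compactness
  \<open>Re (\<mu> * cis \<alpha>) \<le> - d < 0\<close> uniformly, so the weight decays exponentially in the distance to the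
  vertex. With the open interval alone the conclusion can fail.\<close>
lemma integrable_exp_weight_sector:
  assumes neg: "\<And>\<alpha>. \<alpha> \<in> {a..b} \<Longrightarrow> Re (\<mu> * cis \<alpha>) < 0"
    and S: "S \<in> sets lborel" "S \<subseteq> (\<lambda>w. q + w) ` sector a b"
  shows "set_integrable lborel S (exp_weight \<mu>)"
proof -
  obtain d where d: "d > 0" "\<And>\<alpha>. \<alpha> \<in> {a..b} \<Longrightarrow> Re (\<mu> * cis \<alpha>) \<le> - d"
  proof (cases "{a..b} = {}")
    case False
    have "continuous_on {a..b} (\<lambda>\<alpha>. Re (\<mu> * cis \<alpha>))" by (intro continuous_intros)
    from continuous_attains_sup[OF compact_Icc False this]
    obtain \<alpha>0 where "\<alpha>0 \<in> {a..b}" "\<forall>\<alpha>\<in>{a..b}. Re (\<mu> * cis \<alpha>) \<le> Re (\<mu> * cis \<alpha>0)" by blast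
    thus ?thesis using neg[of \<alpha>0] by (intro that[of "- Re (\<mu> * cis \<alpha>0)"]) auto
  qed (auto intro: that[of 1])
  have "integrable lborel (\<lambda>w. exp (2 * Re (\<mu> * q)) * exp (- (2 * d) * cmod (w - q)))"
    by (rule integrable_mult_right[OF integrable_exp_minus_norm]) (use d in auto)
  hence "set_integrable lborel S (\<lambda>w. exp (2 * Re (\<mu> * q)) * exp (- (2 * d) * cmod (w - q)))"
    unfolding set_integrable_def by (rule integrable_mult_indicator[OF S(1)])
  thus ?thesis
  proof (rule set_integrable_bound)
    show "set_borel_measurable lborel S (exp_weight \<mu>)"
      using S by (auto simp: set_borel_measurable_def)
    have "exp_weight \<mu> w \<le> exp (2 * Re (\<mu> * q)) * exp (- (2 * d) * cmod (w - q))" if wS: "w \<in> S" for w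
    proof -
      obtain v where v: "v \<in> sector a b" "w = q + v" using S(2) wS by blast
      have scale: "Re (of_real r * x) = r * Re x" for r x by simp
      have "v = of_real (cmod v) * cis (Arg v)" using rcis_cmod_Arg[of v] by (simp add: rcis_def)
      hence "\<mu> * v = of_real (cmod v) * (\<mu> * cis (Arg v))" by (metis mult.left_commute)
      hence "Re (\<mu> * v) = cmod v * Re (\<mu> * cis (Arg v))"
        by (simp only: scale)
      also have "\<dots> \<le> cmod v * (- d)" using v by (intro mult_left_mono d) (auto simp: sector_def)
      finally have "Re (\<mu> * w) \<le> Re (\<mu> * q) - d * cmod (w - q)" by (simp add: v distrib_left mult.commute)
      hence "2 * Re (\<mu> * w) \<le> 2 * Re (\<mu> * q) + - (2 * d) * cmod (w - q)" by simp
      thus ?thesis by (simp only: exp_add[symmetric] exp_le_cancel_iff)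
    qed
    thus "AE w in lborel. w \<in> S \<longrightarrow> norm (exp_weight \<mu> w) \<le> norm (exp (2 * Re (\<mu> * q)) * exp (- (2 * d) * cmod (w - q)))"
      by (intro AE_I2) auto
  qed
qed

text \<open>Seen from far away the vertices \<open>q\<close> and \<open>q'\<close> coincide: along a ray of the inner sector the
  argument relative to \<open>q'\<close> tends to the direction of the ray, so every direction of the inner
  sector lies in the closure of those of the outer one.\<close>
lemma sector_translate_subset_imp_bounds:
  assumes ab: "- pi \<le> a" "a < b" "b \<le> pi"
    and sub: "(\<lambda>w. q + w) ` sector a b \<subseteq> (\<lambda>w. q' + w) ` sector a' b'"
  shows "a' \<le> a" and "b \<le> b'"
proof -
  have in': "\<alpha> \<in> {a'..b'}" if \<alpha>: "\<alpha> \<in> {a<..<b}" for \<alpha>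
  proof -
    have arg: "Arg (cis \<alpha>) = \<alpha>" using ab \<alpha> by (intro Arg_cis) auto
    define x where "x n = (q - q') / of_nat (Suc n) + cis \<alpha>" for n
    have "(\<lambda>n. (q - q') * (1 / of_nat (Suc n)) + cis \<alpha>) \<longlonglongrightarrow> (q - q') * 0 + cis \<alpha>"
      by (intro tendsto_intros LIMSEQ_Suc[OF lim_1_over_n])
    hence "x \<longlonglongrightarrow> cis \<alpha>" by (simp add: x_def[abs_def])
    hence lim: "(\<lambda>n. Arg (x n)) \<longlonglongrightarrow> \<alpha>"
      using isCont_tendsto_compose[OF isCont_Arg_cis, of \<alpha> x] ab \<alpha> arg by auto
    have "Arg (x n) \<in> {a'<..<b'}" for n
    proof -
      have "cis \<alpha> \<in> sector a b" using \<alpha> arg by (auto simp: sector_def)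
      hence "of_real (real (Suc n)) * cis \<alpha> \<in> sector a b" by (intro mult_mem_sector) auto
      then obtain v where v: "v \<in> sector a' b'" "q + of_real (real (Suc n)) * cis \<alpha> = q' + v"
        using sub by (auto simp: image_subset_iff image_iff)
      have "x n = of_real (1 / real (Suc n)) * v"
      proof -
        have "v = (q - q') + of_nat (Suc n) * cis \<alpha>" using v(2) by (simp add: algebra_simps)
        thus ?thesis by (simp add: x_def field_simps del: of_nat_Suc)
      qed
      moreover have "of_real (1 / real (Suc n)) * v \<in> sector a' b'" by (intro mult_mem_sector v) auto
      ultimately show ?thesis by (auto simp: sector_def)
    qed
    hence "a' \<le> Arg (x n)" "Arg (x n) \<le> b'" for n by (auto simp: less_imp_le)
    thus ?thesis
      using LIMSEQ_le_const[OF lim, of a'] LIMSEQ_le_const2[OF lim, of b'] by auto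
  qed
  show "a' \<le> a"
    by (rule dense_ge_bounded[OF ab(2)]) (use in' in auto)
  show "b \<le> b'"
    by (rule dense_le_bounded[OF ab(2)]) (use in' in auto)
qed

section \<open>Polar form of the eigenvalues\<close>

text \<open>Eigenvalues are written as \<open>r * (\<i> * cis \<psi>)\<close>, the form of the points of \<open>rot_i (sector a b)\<close>. The
  exponential weight then decays in the directions \<open>\<alpha>\<close> with \<open>sin (\<psi> + \<alpha>) > 0\<close>.\<close>
lemma Re_mult_cis_direction:
  "Re (of_real r * (\<i> * cis \<psi>) * cis \<alpha>) = - r * sin (\<psi> + \<alpha>)"
  by (simp add: sin_add algebra_simps)

lemma Re_neg_imp_polar_form:
  assumes "Re \<mu> < 0"
  obtains r \<psi> where "r > 0" "\<psi> \<in> {0<..<pi}" "\<mu> = of_real r * (\<i> * cis \<psi>)"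
proof
  let ?\<psi> = "Arg (- \<i> * \<mu>)"
  show "cmod \<mu> > 0" using assms by auto
  show "?\<psi> \<in> {0<..<pi}" using Arg_lt_pi[of "- \<i> * \<mu>"] assms by simp
  have "- \<i> * \<mu> = of_real (cmod \<mu>) * cis ?\<psi>"
    using rcis_cmod_Arg[of "- \<i> * \<mu>"] by (simp add: rcis_def norm_mult)
  hence "\<i> * (- \<i> * \<mu>) = \<i> * (of_real (cmod \<mu>) * cis ?\<psi>)" by simp
  thus "\<mu> = of_real (cmod \<mu>) * (\<i> * cis ?\<psi>)" by (simp add: mult_ac)
qed

lemma rot_i_sector_iff:
  assumes "- pi \<le> a" "b \<le> pi"
  shows "\<mu> \<in> rot_i (sector a b) \<longleftrightarrow> (\<exists>r \<psi>. r > 0 \<and> \<psi> \<in> {a<..<b} \<and> \<mu> = of_real r * (\<i> * cis \<psi>))"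
proof
  assume "\<mu> \<in> rot_i (sector a b)"
  then obtain w where w: "w \<in> sector a b" "\<mu> = \<i> * w" by (auto simp: rot_i_def)
  have "w = of_real (cmod w) * cis (Arg w)" using rcis_cmod_Arg[of w] by (simp add: rcis_def)
  hence "\<mu> = of_real (cmod w) * (\<i> * cis (Arg w))" using w by (metis mult.left_commute)
  thus "\<exists>r \<psi>. r > 0 \<and> \<psi> \<in> {a<..<b} \<and> \<mu> = of_real r * (\<i> * cis \<psi>)"
    using w by (intro exI[of _ "cmod w"] exI[of _ "Arg w"]) (auto simp: sector_def)
next
  assume "\<exists>r \<psi>. r > 0 \<and> \<psi> \<in> {a<..<b} \<and> \<mu> = of_real r * (\<i> * cis \<psi>)"
  then obtain r \<psi> where *: "r > 0" "\<psi> \<in> {a<..<b}" "\<mu> = of_real r * (\<i> * cis \<psi>)" by blast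
  have "Arg (cis \<psi>) = \<psi>" using * assms by (intro Arg_cis) auto
  hence "of_real r * cis \<psi> \<in> sector a b" using * by (intro mult_mem_sector) (auto simp: sector_def)
  moreover have "\<mu> = \<i> * (of_real r * cis \<psi>)" using * by (simp add: mult_ac)
  ultimately show "\<mu> \<in> rot_i (sector a b)" unfolding rot_i_def by blast
qed

text \<open>Polar coordinates are continuous, so they map the closure of the parameter rectangle into the
  closure of the sector.\<close>
lemma polar_in_closure_sector:
  assumes "- pi \<le> a" "a < b" "b \<le> pi" "\<psi> \<in> {a..b}" "r \<ge> 0"
  shows "of_real r * cis \<psi> \<in> closure (sector a b)"
proof -
  \<comment> \<open>The rectangle is bounded at \<open>r + 1\<close> so that the closure of both factors is a closed interval containing the given parameter.\<close>
  have "closure ({0<..<r + 1} \<times> {a<..<b}) = {0..r + 1} \<times> {a..b}"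
    using assms by (simp add: closure_Times)
  hence "(r, \<psi>) \<in> closure ({0<..<r + 1} \<times> {a<..<b})" using assms by auto
  hence "(\<lambda>(r, \<psi>). of_real r * cis \<psi>) (r, \<psi>) \<in> (\<lambda>(r, \<psi>). of_real r * cis \<psi>) ` closure ({0<..<r + 1} \<times> {a<..<b})"
    by (rule imageI)
  also have "\<dots> \<subseteq> closure (sector a b)"
  proof (rule image_closure_subset)
    show "continuous_on (closure ({0<..<r + 1} \<times> {a<..<b})) (\<lambda>(r, \<psi>). of_real r * cis \<psi>)"
      unfolding case_prod_unfold by (intro continuous_intros)
    show "(\<lambda>(r, \<psi>). of_real r * cis \<psi>) ` ({0<..<r + 1} \<times> {a<..<b}) \<subseteq> closure (sector a b)"
    proof clarify
      fix s \<psi> :: real assume *: "s \<in> {0<..<r + 1}" "\<psi> \<in> {a<..<b}"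
      have "Arg (cis \<psi>) = \<psi>" using * assms by (intro Arg_cis) auto
      hence "of_real s * cis \<psi> \<in> sector a b"
        using * by (intro mult_mem_sector) (auto simp: sector_def)
      thus "of_real s * cis \<psi> \<in> closure (sector a b)" using closure_subset by blast
    qed
  qed simp
  finally show ?thesis by simp
qed

section \<open>Inner and outer arguments\<close>

lemma bdd_above_lower_inner_openings: "bdd_above ({0} \<union> {\<theta>\<in>{0<..pi}. \<exists>q. (\<lambda>w. q + w) ` sector (- \<theta>) 0 \<subseteq> lower_part \<Omega>})"
  and bdd_above_upper_inner_openings: "bdd_above ({0} \<union> {\<theta>\<in>{0<..pi}. \<exists>q. (\<lambda>w. q + w) ` sector 0 \<theta> \<subseteq> upper_part \<Omega>})"
  by (auto intro: bdd_aboveI[of _ pi])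

text \<open>The parts of \<open>\<Omega>\<close> are cut out by half-planes, which are sectors of opening \<open>pi\<close> with vertex \<open>0\<close>.\<close>
lemma pi_mem_lower_outer_openings: "pi \<in> {\<theta>\<in>{0<..pi}. \<exists>q. lower_part \<Omega> \<subseteq> (\<lambda>w. q + w) ` sector (- \<theta>) 0}"
  and pi_mem_upper_outer_openings: "pi \<in> {\<theta>\<in>{0<..pi}. \<exists>q. upper_part \<Omega> \<subseteq> (\<lambda>w. q + w) ` sector 0 \<theta>}"
  by (auto intro!: exI[of _ 0] simp: lower_part_def upper_part_def)

lemma inner_arg_nonneg: "0 \<le> lower_inner_arg \<Omega>" "0 \<le> upper_inner_arg \<Omega>"
  unfolding lower_inner_arg_def upper_inner_arg_def
  by (intro cSup_upper bdd_above_lower_inner_openings bdd_above_upper_inner_openings; simp)+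

lemma outer_arg_nonneg: "0 \<le> lower_outer_arg \<Omega>" "0 \<le> upper_outer_arg \<Omega>"
  unfolding lower_outer_arg_def upper_outer_arg_def
  using pi_mem_lower_outer_openings pi_mem_upper_outer_openings by (intro cInf_greatest; force)+

lemma inner_arg_le_outer_arg:
  "lower_inner_arg \<Omega> \<le> lower_outer_arg \<Omega>" "upper_inner_arg \<Omega> \<le> upper_outer_arg \<Omega>"
proof -
  have l: "\<theta> \<le> \<theta>'" if "\<theta> \<in> {0<..pi}" "(\<lambda>w. q + w) ` sector (- \<theta>) 0 \<subseteq> lower_part \<Omega>"
      "lower_part \<Omega> \<subseteq> (\<lambda>w. q' + w) ` sector (- \<theta>') 0" for \<theta> \<theta>' q q'
    using sector_translate_subset_imp_bounds(1)[of "- \<theta>" 0 q q' "- \<theta>'" 0] that by auto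
  have u: "\<theta> \<le> \<theta>'" if "\<theta> \<in> {0<..pi}" "(\<lambda>w. q + w) ` sector 0 \<theta> \<subseteq> upper_part \<Omega>"
      "upper_part \<Omega> \<subseteq> (\<lambda>w. q' + w) ` sector 0 \<theta>'" for \<theta> \<theta>' q q'
    using sector_translate_subset_imp_bounds(2)[of 0 \<theta> q q' 0 \<theta>'] that by auto
  show "lower_inner_arg \<Omega> \<le> lower_outer_arg \<Omega>"
    unfolding lower_inner_arg_def lower_outer_arg_def
  proof (intro cSup_least cInf_greatest)
    show "{\<theta> \<in> {0<..pi}. \<exists>q. lower_part \<Omega> \<subseteq> (\<lambda>w. q + w) ` sector (- \<theta>) 0} \<noteq> {}"
      using pi_mem_lower_outer_openings by blast
  qed (use l in auto)
  show "upper_inner_arg \<Omega> \<le> upper_outer_arg \<Omega>"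
    unfolding upper_inner_arg_def upper_outer_arg_def
  proof (intro cSup_least cInf_greatest)
    show "{\<theta> \<in> {0<..pi}. \<exists>q. upper_part \<Omega> \<subseteq> (\<lambda>w. q + w) ` sector 0 \<theta>} \<noteq> {}"
      using pi_mem_upper_outer_openings by blast
  qed (use u in auto)
qed

text \<open>A translated sector contained in \<open>\<Omega>\<close> forces \<open>sin (\<psi> + \<alpha>) \<ge> 0\<close> for all its directions \<open>\<alpha>\<close>. As
  \<open>\<psi>\<close> lies between \<open>0\<close> and \<open>pi\<close>, this means that \<open>\<psi> + \<alpha>\<close> stays between \<open>0\<close> and \<open>pi\<close>, and the extreme
  directions \<open>- \<theta>\<close> and \<open>\<theta>\<close> of the lower and the upper sectors give the two bounds.\<close>
lemma integrable_exp_weight_imp_angle_bounds: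
  assumes int: "set_integrable lborel \<Omega> (exp_weight (of_real r * (\<i> * cis \<psi>)))"
    and r: "r > 0" and \<psi>: "\<psi> \<in> {0<..<pi}"
  shows "lower_inner_arg \<Omega> \<le> \<psi>" and "\<psi> \<le> pi - upper_inner_arg \<Omega>"
proof -
  have sin_nonneg: "0 \<le> sin (\<psi> + \<alpha>)"
    if "- pi \<le> a" "b \<le> pi" "(\<lambda>w. q + w) ` sector a b \<subseteq> \<Omega>" "\<alpha> \<in> {a<..<b}" for a b q \<alpha>
    using integrable_exp_weight_imp_Re_nonpos_on_sector[OF that(1-3) int that(4)] r
    unfolding Re_mult_cis_direction by (simp add: zero_le_mult_iff)
  have l: "\<theta> \<le> \<psi>" if \<theta>: "\<theta> \<in> {0<..pi}" and q: "(\<lambda>w. q + w) ` sector (- \<theta>) 0 \<subseteq> lower_part \<Omega>" for \<theta> q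
  proof (rule ccontr)
    assume less: "\<not> \<theta> \<le> \<psi>"
    \<comment> \<open>A direction of the sector strictly below \<open>- \<psi>\<close>, where the sine is negative.\<close>
    define \<alpha> where "\<alpha> = - (\<theta> + \<psi>) / 2"
    have \<alpha>: "- \<theta> < \<alpha>" "\<alpha> < - \<psi>" using less by (auto simp: \<alpha>_def)
    have "0 \<le> sin (\<psi> + \<alpha>)"
      by (rule sin_nonneg[of "- \<theta>" 0 q]) (use \<theta> q \<alpha> \<psi> in \<open>auto simp: lower_part_def\<close>)
    moreover have "sin (- (\<psi> + \<alpha>)) > 0" by (rule sin_gt_zero) (use \<alpha> \<psi> \<theta> in auto)
    ultimately show False by (simp only: sin_minus)
  qed
  have u: "\<theta> \<le> pi - \<psi>" if \<theta>: "\<theta> \<in> {0<..pi}" and q: "(\<lambda>w. q + w) ` sector 0 \<theta> \<subseteq> upper_part \<Omega>" for \<theta> q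
  proof (rule ccontr)
    assume less: "\<not> \<theta> \<le> pi - \<psi>"
    \<comment> \<open>A direction of the sector strictly above \<open>pi - \<psi>\<close>, where the sine is negative.\<close>
    define \<alpha> where "\<alpha> = (\<theta> + (pi - \<psi>)) / 2"
    have \<alpha>: "\<alpha> < \<theta>" "pi - \<psi> < \<alpha>" using less by (auto simp: \<alpha>_def)
    have "0 \<le> sin (\<psi> + \<alpha>)"
      by (rule sin_nonneg[of 0 \<theta> q]) (use \<theta> q \<alpha> \<psi> in \<open>auto simp: upper_part_def\<close>)
    moreover have "sin (\<psi> + \<alpha> - pi) > 0" by (rule sin_gt_zero) (use \<alpha> \<psi> \<theta> in auto)
    ultimately show False by (simp add: sin_diff)
  qed
  show "lower_inner_arg \<Omega> \<le> \<psi>"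
    unfolding lower_inner_arg_def by (rule cSup_least) (use l \<psi> in auto)
  have "upper_inner_arg \<Omega> \<le> pi - \<psi>"
    unfolding upper_inner_arg_def by (rule cSup_least) (use u \<psi> in auto)
  thus "\<psi> \<le> pi - upper_inner_arg \<Omega>" by simp
qed

lemma negligible_real_axis: "{w. Im w = 0} \<in> null_sets lborel"
proof -
  have "negligible {w :: complex. \<i> \<bullet> w = 0}"
    by (rule negligible_hyperplane) simp
  hence "{w. Im w = 0} \<in> null_sets lebesgue" by (simp add: negligible_iff_null_sets)
  moreover have "{w. Im w = 0} \<in> sets lborel"
    using closed_halfspace_Im_eq[of 0] by simp
  ultimately show ?thesis by (auto simp: null_sets_def)
qed

lemma sector_lower_half_plane: "sector (- pi) 0 = {w. Im w < 0}"
  using Arg_neg_iff mpi_less_Arg by (auto simp: sector_def)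

lemma sector_upper_half_plane: "sector 0 pi = {w. Im w > 0}"
  using Arg_lt_pi by (auto simp: sector_def)

text \<open>Strict inequalities leave room for outer sectors of openings \<open>\<theta> < \<psi>\<close> and \<open>\<theta>' < pi - \<psi>\<close>. On their
  closed ranges of directions \<open>\<psi> + \<alpha>\<close> remains inside the open interval from \<open>0\<close> to \<open>pi\<close>, so the
  weight is integrable over both parts of \<open>\<Omega>\<close>; the rest of \<open>\<Omega>\<close> lies on the real axis.\<close>
lemma angle_bounds_imp_integrable_exp_weight:
  assumes op: "open \<Omega>" and r: "r > 0"
    and l: "lower_outer_arg \<Omega> < \<psi>" and u: "\<psi> < pi - upper_outer_arg \<Omega>"
  shows "set_integrable lborel \<Omega> (exp_weight (of_real r * (\<i> * cis \<psi>)))"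
proof -
  let ?\<mu> = "of_real r * (\<i> * cis \<psi>)"
  have "\<exists>\<theta>\<in>{\<theta>\<in>{0<..pi}. \<exists>q. lower_part \<Omega> \<subseteq> (\<lambda>w. q + w) ` sector (- \<theta>) 0}. \<theta> < \<psi>"
    using l pi_mem_lower_outer_openings unfolding lower_outer_arg_def by (intro cInf_lessD) blast
  then obtain \<theta> q where \<theta>: "\<theta> < \<psi>" "\<theta> > 0" "lower_part \<Omega> \<subseteq> (\<lambda>w. q + w) ` sector (- \<theta>) 0"
    by auto
  have "upper_outer_arg \<Omega> < pi - \<psi>" using u by simp
  hence "\<exists>\<theta>\<in>{\<theta>\<in>{0<..pi}. \<exists>q. upper_part \<Omega> \<subseteq> (\<lambda>w. q + w) ` sector 0 \<theta>}. \<theta> < pi - \<psi>"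
    using pi_mem_upper_outer_openings unfolding upper_outer_arg_def by (intro cInf_lessD) blast
  then obtain \<theta>' q' where \<theta>': "\<theta>' < pi - \<psi>" "\<theta>' > 0" "upper_part \<Omega> \<subseteq> (\<lambda>w. q' + w) ` sector 0 \<theta>'"
    by auto
  have meas: "lower_part \<Omega> \<in> sets lborel" "upper_part \<Omega> \<in> sets lborel"
    using op by (auto simp: lower_part_def upper_part_def sector_lower_half_plane sector_upper_half_plane
        open_halfspace_Im_lt open_halfspace_Im_gt)
  have neg: "Re (?\<mu> * cis \<alpha>) < 0" if "\<psi> + \<alpha> \<in> {0<..<pi}" for \<alpha>
    unfolding Re_mult_cis_direction using r that sin_gt_zero[of "\<psi> + \<alpha>"] by simp
  have "set_integrable lborel (lower_part \<Omega>) (exp_weight ?\<mu>)"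
    by (rule integrable_exp_weight_sector[OF neg meas(1) \<theta>(3)]) (use \<theta> \<theta>' in auto)
  moreover have "set_integrable lborel (upper_part \<Omega>) (exp_weight ?\<mu>)"
    by (rule integrable_exp_weight_sector[OF neg meas(2) \<theta>'(3)]) (use \<theta> \<theta>' in auto)
  ultimately have "set_integrable lborel (lower_part \<Omega> \<union> upper_part \<Omega>) (exp_weight ?\<mu>)"
    using meas by (intro set_integrable_Un)
  also have "?this \<longleftrightarrow> ?thesis"
    unfolding set_integrable_def
  proof (rule integrable_cong_AE)
    have "AE w in lborel. w \<notin> {w. Im w = 0}" by (rule AE_not_in[OF negligible_real_axis])
    thus "AE w in lborel. indicator (lower_part \<Omega> \<union> upper_part \<Omega>) w *\<^sub>R exp_weight ?\<mu> w =
        indicator \<Omega> w *\<^sub>R exp_weight ?\<mu> w"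
      by eventually_elim
        (auto simp: lower_part_def upper_part_def sector_lower_half_plane sector_upper_half_plane
            indicator_def simp del: times_complex.simps)
  qed (use meas op in \<open>simp_all del: times_complex.simps\<close>)
  finally show ?thesis .
qed

section \<open>The point spectrum of the generator\<close>

text \<open>The number \<open>0\<close> is always an eigenvalue, with the constants as eigenfunctions. A nonzero eigenvalue
  has \<open>\<psi>\<close> strictly between \<open>0\<close> and \<open>pi\<close> and in the closed interval bounded by the inner arguments, and
  every \<open>\<psi>\<close> in the open interval bounded by the outer arguments occurs. The cases differ in whether
  these intervals are nondegenerate, reduced to a point, or empty.\<close>
theorem theorem1p4:
  fixes \<phi> :: "real \<Rightarrow> complex \<Rightarrow> complex" and \<Omega> :: "complex set"
  assumes "parabolic_semigroup \<phi>"
    and "koenigs_domain \<phi> \<Omega>"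
    and "zero_hyperbolic_step \<Omega>"
    and "\<Omega> \<subseteq> UNIV - {- complex_of_real t | t. t \<ge> 0}"
  shows
    "(inner_arg \<Omega> = 0 \<and> outer_arg \<Omega> = 0 \<longrightarrow>
        dirichlet_point_spectrum \<phi> = rot_i (sector 0 pi) \<union> {0})
     \<and> (inner_arg \<Omega> = outer_arg \<Omega> \<and> inner_arg \<Omega> \<in> {0<..<pi} \<longrightarrow>
        lower_inner_arg \<Omega> = lower_outer_arg \<Omega> \<and> upper_inner_arg \<Omega> = upper_outer_arg \<Omega> \<and>
        rot_i (sector (lower_inner_arg \<Omega>) (pi - upper_inner_arg \<Omega>)) \<union> {0}
          \<subseteq> dirichlet_point_spectrum \<phi> \<and>
        dirichlet_point_spectrum \<phi>
          \<subseteq> rot_i (closure (sector (lower_inner_arg \<Omega>) (pi - upper_inner_arg \<Omega>))))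
     \<and> (inner_arg \<Omega> = pi \<longrightarrow>
        dirichlet_point_spectrum \<phi>
          \<subseteq> {\<i> * of_real t * exp (\<i> * of_real (lower_inner_arg \<Omega>)) | t. t \<ge> 0})
     \<and> (inner_arg \<Omega> \<in> {pi<..2 * pi} \<longrightarrow> dirichlet_point_spectrum \<phi> = {0})
     \<and> (inner_arg \<Omega> < min pi (outer_arg \<Omega>) \<longrightarrow>
        (if outer_arg \<Omega> \<ge> pi then {0}
         else rot_i (sector (lower_outer_arg \<Omega>) (pi - upper_outer_arg \<Omega>)) \<union> {0})
          \<subseteq> dirichlet_point_spectrum \<phi> \<and>
        dirichlet_point_spectrum \<phi>
          \<subseteq> (if inner_arg \<Omega> = 0 then rot_i (sector 0 pi) \<union> {0}
             else rot_i (closure (sector (lower_inner_arg \<Omega>) (pi - upper_inner_arg \<Omega>)))))"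
proof -
  obtain h where koe: "koenigs_function \<phi> h" and \<Omega>: "\<Omega> = h ` unit_disk"
    using assms(2) by (auto simp: koenigs_domain_def)
  interpret koenigs_semigroup \<phi> h
    using assms(1) koe by unfold_locales (simp_all add: parabolic_semigroup_def)
  have op: "open \<Omega>" using open_koenigs_domain by (simp add: \<Omega>)
  note spec = dirichlet_point_spectrum_iff[folded \<Omega>]
  let ?\<sigma> = "dirichlet_point_spectrum \<phi>"
  let ?l = "lower_inner_arg \<Omega>" and ?u = "upper_inner_arg \<Omega>"
  let ?L = "lower_outer_arg \<Omega>" and ?U = "upper_outer_arg \<Omega>"
  note nonneg = inner_arg_nonneg[of \<Omega>] outer_arg_nonneg[of \<Omega>] and le = inner_arg_le_outer_arg[of \<Omega>]
  have zero: "0 \<in> ?\<sigma>" by (simp add: spec)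
  have polar: "\<exists>r \<psi>. r > 0 \<and> \<psi> \<in> {0<..<pi} \<and> ?l \<le> \<psi> \<and> \<psi> \<le> pi - ?u \<and> \<mu> = of_real r * (\<i> * cis \<psi>)"
    if "\<mu> \<in> ?\<sigma>" "\<mu> \<noteq> 0" for \<mu>
  proof -
    have int: "set_integrable lborel \<Omega> (exp_weight \<mu>)" using that by (simp only: spec simp_thms)
    have "Re \<mu> < 0"
      by (rule integrable_exp_weight_imp_Re_neg[OF op _ _ int])
        (use koenigs_domain_translate in \<open>auto simp: \<Omega>\<close>)
    then obtain r \<psi> where *: "r > 0" "\<psi> \<in> {0<..<pi}" "\<mu> = of_real r * (\<i> * cis \<psi>)"
      by (rule Re_neg_imp_polar_form)
    with integrable_exp_weight_imp_angle_bounds[of \<Omega> r \<psi>] int show ?thesis by blast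
  qed
  have lower: "rot_i (sector ?L (pi - ?U)) \<union> {0} \<subseteq> ?\<sigma>"
  proof -
    have "\<mu> \<in> ?\<sigma>" if "\<mu> \<in> rot_i (sector ?L (pi - ?U))" for \<mu>
    proof -
      have "- pi \<le> ?L" "pi - ?U \<le> pi" using nonneg pi_ge_zero by linarith+
      hence "\<exists>r \<psi>. r > 0 \<and> \<psi> \<in> {?L<..<pi - ?U} \<and> \<mu> = of_real r * (\<i> * cis \<psi>)"
        using rot_i_sector_iff that by blast
      thus ?thesis
        unfolding spec using angle_bounds_imp_integrable_exp_weight[OF op] by auto
    qed
    thus ?thesis using zero by blast
  qed
  have upper_half: "?\<sigma> \<subseteq> rot_i (sector 0 pi) \<union> {0}"
  proof
    fix \<mu> assume "\<mu> \<in> ?\<sigma>"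
    thus "\<mu> \<in> rot_i (sector 0 pi) \<union> {0}"
      using polar[of \<mu>] rot_i_sector_iff[of 0 pi \<mu>] by auto
  qed
  have upper_closure: "?\<sigma> \<subseteq> rot_i (closure (sector ?l (pi - ?u)))" if less: "?l < pi - ?u"
  proof
    fix \<mu> assume \<mu>: "\<mu> \<in> ?\<sigma>"
    have "\<exists>r \<psi>. r \<ge> 0 \<and> \<psi> \<in> {?l..pi - ?u} \<and> \<mu> = \<i> * (of_real r * cis \<psi>)"
    proof (cases "\<mu> = 0")
      case True
      thus ?thesis using less by (intro exI[of _ 0] exI[of _ ?l]) auto
    next
      case False
      then obtain r \<psi> where "r > 0" "?l \<le> \<psi>" "\<psi> \<le> pi - ?u" "\<mu> = of_real r * (\<i> * cis \<psi>)"
        using polar[OF \<mu>] by blast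
      thus ?thesis by (intro exI[of _ r] exI[of _ \<psi>]) (simp add: mult_ac)
    qed
    then obtain r \<psi> where "r \<ge> 0" "\<psi> \<in> {?l..pi - ?u}" "\<mu> = \<i> * (of_real r * cis \<psi>)" by blast
    moreover from this have "of_real r * cis \<psi> \<in> closure (sector ?l (pi - ?u))"
      using less nonneg by (intro polar_in_closure_sector) auto
    ultimately show "\<mu> \<in> rot_i (closure (sector ?l (pi - ?u)))" unfolding rot_i_def by blast
  qed
  have a: "?\<sigma> = rot_i (sector 0 pi) \<union> {0}" if "outer_arg \<Omega> = 0"
  proof -
    have "?L = 0" "?U = 0" using that nonneg by (auto simp: outer_arg_def)
    thus ?thesis using lower upper_half by auto
  qed
  have b: "?l = ?L \<and> ?u = ?U" if "inner_arg \<Omega> = outer_arg \<Omega>"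
    using that le by (auto simp: inner_arg_def outer_arg_def)
  have c: "?\<sigma> \<subseteq> {\<i> * of_real t * exp (\<i> * of_real ?l) | t. t \<ge> 0}" if "inner_arg \<Omega> = pi"
  proof
    fix \<mu> assume \<mu>: "\<mu> \<in> ?\<sigma>"
    have "\<exists>t\<ge>0. \<mu> = \<i> * of_real t * exp (\<i> * of_real ?l)"
    proof (cases "\<mu> = 0")
      case False
      then obtain r \<psi> where *: "r > 0" "?l \<le> \<psi>" "\<psi> \<le> pi - ?u" "\<mu> = of_real r * (\<i> * cis \<psi>)"
        using polar[OF \<mu>] by blast
      hence "\<psi> = ?l" using that by (simp add: inner_arg_def)
      thus ?thesis using * by (intro exI[of _ r]) (simp add: cis_conv_exp mult_ac)
    qed (auto intro: exI[of _ 0])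
    thus "\<mu> \<in> {\<i> * of_real t * exp (\<i> * of_real ?l) | t. t \<ge> 0}" by blast
  qed
  have d: "?\<sigma> = {0}" if "inner_arg \<Omega> > pi"
  proof -
    have "\<mu> = 0" if "\<mu> \<in> ?\<sigma>" for \<mu>
      using polar[OF that] \<open>inner_arg \<Omega> > pi\<close> by (force simp: inner_arg_def)
    thus ?thesis using zero by blast
  qed
  have less_iff: "?l < pi - ?u \<longleftrightarrow> inner_arg \<Omega> < pi" by (auto simp: inner_arg_def)
  show ?thesis
  proof (intro conjI impI)
    assume "inner_arg \<Omega> = 0 \<and> outer_arg \<Omega> = 0"
    thus "?\<sigma> = rot_i (sector 0 pi) \<union> {0}" using a by blast
  next
    assume *: "inner_arg \<Omega> = outer_arg \<Omega> \<and> inner_arg \<Omega> \<in> {0<..<pi}"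
    thus eq: "?l = ?L" "?u = ?U" using b by auto
    show "rot_i (sector ?l (pi - ?u)) \<union> {0} \<subseteq> ?\<sigma>" using lower by (simp only: eq)
    show "?\<sigma> \<subseteq> rot_i (closure (sector ?l (pi - ?u)))"
      using upper_closure less_iff * by auto
  next
    assume "inner_arg \<Omega> = pi"
    thus "?\<sigma> \<subseteq> {\<i> * of_real t * exp (\<i> * of_real ?l) | t. t \<ge> 0}" by (rule c)
  next
    assume "inner_arg \<Omega> \<in> {pi<..2 * pi}"
    thus "?\<sigma> = {0}" using d by auto
  next
    assume *: "inner_arg \<Omega> < min pi (outer_arg \<Omega>)"
    show "(if outer_arg \<Omega> \<ge> pi then {0} else rot_i (sector ?L (pi - ?U)) \<union> {0}) \<subseteq> ?\<sigma>"
      using lower zero by auto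
    show "?\<sigma> \<subseteq> (if inner_arg \<Omega> = 0 then rot_i (sector 0 pi) \<union> {0}
             else rot_i (closure (sector ?l (pi - ?u))))"
      using upper_half upper_closure less_iff * by auto
  qed
qed

end
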